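(* Let $W>0$ be any constant. Let $\Omega\subset\mathbb{R}^2_+$ be an open bounded set satisfying $\int_\Omega x_2\,d\mathbf{x}>0$. Assume that for some function $l:(0,\infty)\to[0,\infty)$, $$\{(x_1,x_2)\in\Omega: x_2=s\}=\{(x_1,s)\in\mathbb{R}^2_+: |x_1|<l(s)\}\quad\text{for each }s>0,$$ and that the function $\theta:[0,\infty)\times\mathbb{R}^2\to\mathbb{R}$ given by $\theta(t,\mathbf{x}):=(\mathbf{1}_\Omega-\mathbf{1}_{\Omega_-})(\mathbf{x}-(W,0)t)$ solves the 2D incompressible Euler equations in vorticity form. Then the velocity $\mathbf{u}=(u^1,u^2):[0,\infty)\times\mathbb{R}^2\to\mathbb{R}^2$, $\mathbf{u}=k*\theta$, satisfies $$u^1\big(t,(Wt,0)\big)=u^1\big(0,(0,0)\big)>2W\quad\text{and}\quad u^2\big(t,(Wt,0)\big)=u^2\big(0,(0,0)\big)=0\quad\text{for each }t>0.$$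
   Context: $\mathbb{R}^2_+:=\{(x_1,x_2)\in\mathbb{R}^2: x_2>0\}$. For $A\subset\mathbb{R}^2_+$, $A_-:=\{(x_1,x_2)\in\mathbb{R}^2:(x_1,-x_2)\in A\}$. $k(\mathbf{x})=\frac{1}{2\pi}\frac{(-x_2,x_1)}{|\mathbf{x}|^2}$ is the Biot–Savart kernel. The 2D incompressible Euler equations in vorticity form are $\partial_t\theta+\mathbf{u}\cdot\nabla\theta=0$, $\mathbf{u}=k*\theta$ (convolution in space), with $\theta|_{t=0}=\theta_0$. For discontinuous $\theta$ the equation is understood in the weak sense, i.e. $\partial_t\theta+\nabla\cdot(\mathbf{u}\theta)=0$ in the sense of distributions. *)

theory Defs
  imports "HOL-Analysis.Analysis"
begin

text \<open>The plane is \<^typ>\<open>real \<times> real\<close>, whose norm and measure \<^const>\<open>lborel\<close> are the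
  Euclidean ones; space-time points are nested pairs \<open>(t, (x\<^sub>1, x\<^sub>2))\<close>.\<close>

definition upper_half_plane :: "(real \<times> real) set" where
  "upper_half_plane = {x. snd x > 0}"

definition reflect_set :: "(real \<times> real) set \<Rightarrow> (real \<times> real) set" where
  "reflect_set A = {x. (fst x, - snd x) \<in> A}"

definition biot_savart :: "real \<times> real \<Rightarrow> real \<times> real" where
  "biot_savart x = (1 / (2 * pi)) *\<^sub>R ((1 / (norm x)\<^sup>2) *\<^sub>R (- snd x, fst x))"

definition convolution ::
    "(real \<times> real \<Rightarrow> real \<times> real) \<Rightarrow> (real \<times> real \<Rightarrow> real) \<Rightarrow> real \<times> real \<Rightarrow> real \<times> real" where
  "convolution k f x = (LINT y|lborel. f y *\<^sub>R k (x - y))"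

definition velocity ::
    "(real \<Rightarrow> real \<times> real \<Rightarrow> real) \<Rightarrow> real \<Rightarrow> real \<times> real \<Rightarrow> real \<times> real" where
  "velocity \<theta> t = convolution biot_savart (\<theta> t)"

fun C_k :: "nat \<Rightarrow> ('a::euclidean_space \<Rightarrow> real) \<Rightarrow> bool" where
  "C_k 0 f \<longleftrightarrow> continuous_on UNIV f"
| "C_k (Suc n) f \<longleftrightarrow> (\<forall>x. f differentiable (at x)) \<and>
     (\<forall>b\<in>Basis. C_k n (\<lambda>x. frechet_derivative f (at x) b))"

definition smooth :: "('a::euclidean_space \<Rightarrow> real) \<Rightarrow> bool" where
  "smooth f \<longleftrightarrow> (\<forall>n. C_k n f)"

definition supp :: "('a::topological_space \<Rightarrow> real) \<Rightarrow> 'a set" where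
  "supp f = closure {x. f x \<noteq> 0}"

definition test_function :: "'a::euclidean_space set \<Rightarrow> ('a \<Rightarrow> real) \<Rightarrow> bool" where
  "test_function U \<phi> \<longleftrightarrow> smooth \<phi> \<and> compact (supp \<phi>) \<and> supp \<phi> \<subseteq> U"

definition dt :: "(real \<times> real \<times> real \<Rightarrow> real) \<Rightarrow> real \<times> real \<times> real \<Rightarrow> real" where
  "dt \<phi> z = frechet_derivative \<phi> (at z) (1, 0, 0)"

definition grad :: "(real \<times> real \<times> real \<Rightarrow> real) \<Rightarrow> real \<times> real \<times> real \<Rightarrow> real \<times> real" where
  "grad \<phi> z = (frechet_derivative \<phi> (at z) (0, 1, 0), frechet_derivative \<phi> (at z) (0, 0, 1))"

definition space_time :: "(real \<times> real \<times> real) set" where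
  "space_time = {0<..} \<times> UNIV"

text \<open>The pairing with \<open>\<phi>\<close> of \<open>- (\<partial>\<^sub>t \<theta> + \<nabla> \<cdot> (u \<theta>))\<close>, with both derivatives moved onto \<open>\<phi>\<close>,
  must exist and vanish. As the test functions live on the open set \<open>t > 0\<close>, the initial datum is
  imposed separately. Only the values of \<open>\<theta>\<close> at times \<open>t \<ge> 0\<close> matter.\<close>

definition solves_euler_vorticity ::
    "(real \<times> real \<Rightarrow> real) \<Rightarrow> (real \<Rightarrow> real \<times> real \<Rightarrow> real) \<Rightarrow> bool" where
  "solves_euler_vorticity \<theta>\<^sub>0 \<theta> \<longleftrightarrow>
     \<theta> 0 = \<theta>\<^sub>0 \<and>
     (\<forall>\<phi>. test_function space_time \<phi> \<longrightarrow>
        (let F = (\<lambda>z. \<theta> (fst z) (snd z) * (dt \<phi> z + velocity \<theta> (fst z) (snd z) \<bullet> grad \<phi> z))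
         in set_integrable lborel space_time F \<and> (LINT z:space_time|lborel. F z) = 0))"

end

theory Submission
  imports Defs
begin

text \<open>Write \<open>f\<close> for the vorticity at time \<open>0\<close>, \<open>u = k * f\<close>, and \<open>B = \<integral> f x\<^sub>2 / |x|\<^sup>2 = 2\<pi> u\<^sup>1(0)\<close>.
  Testing the equation with a smooth approximation of the (odd) angle function
  \<open>sgn (x\<^sub>2) arctan (x\<^sub>1 / |x\<^sub>2|)\<close>, whose jump across the axis does no harm because \<open>u\<^sup>2\<close> vanishes there, gives
  \<open>W B = \<integral> f (u\<^sup>1 x\<^sub>2 - u\<^sup>2 x\<^sub>1) / |x|\<^sup>2\<close>. Symmetrizing the double integral for
  \<open>\<integral> f (u\<^sup>1 x\<^sub>2 + u\<^sup>2 x\<^sub>1) / |x|\<^sup>2\<close> in its two variables shows that it equals \<open>B\<^sup>2 / 4\<pi>\<close>.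
  The difference of the two is \<open>2 \<integral> f u\<^sup>2 x\<^sub>1 / |x|\<^sup>2\<close>, which is positive because the Steiner symmetry
  of \<open>\<Omega>\<close> forces \<open>u\<^sup>2\<close> to have the sign of \<open>x\<^sub>1\<close> in the upper half-plane. Hence \<open>B / 4\<pi> > W\<close>.\<close>

section \<open>Smooth functions\<close>

text \<open>Off the axis the angle function has gradient (x_2, -x_1)/|x|^2, which is -2\<pi> k(x).
  Paired with (W, 0) it gives W times the density of B; paired with u it gives an expression that
  differs from the symmetrizable one only in the sign of u^2 x_1. The two identities can therefore
  be subtracted, leaving a term of known sign. The factor 2 of the conclusion comes from
  symmetrization, since B^2/(4\<pi>) is half of B u^1(0). The obstacle is the axis. A smoothed jump
  has a vertical derivative of size up to 1/|x_2|, and 1/|x_2| is not integrable. What saves the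
  limit is a rate for the vanishing of u^2: oddness gives |u^2| \<le> C |x_2|^(1/2) on a box
  containing the support, so that the dangerous product is O(|x_2|^(-1/2)), and dominated
  convergence applies. Both this rate and the boundedness of u come from one integrable majorant,
  |z|^(-3/2) on a box. Smoothness of test functions is an infinite recursion on derivatives, so
  every ingredient is built from families that are closed under differentiation.\<close>

lemma C_k_SucI:
  assumes "\<And>x. (f has_derivative f' x) (at x)" "\<And>b. b \<in> Basis \<Longrightarrow> C_k n (\<lambda>x. f' x b)"
  shows "C_k (Suc n) f"
proof -
  have "frechet_derivative f (at x) = f' x" for x
    using frechet_derivative_at[OF assms(1)] by simp
  then show ?thesis
    using assms by (auto simp: differentiable_def)
qed

lemma C_k_Suc_real_I:
  assumes "\<And>x. (f has_real_derivative f' x) (at x)" "C_k n f'"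
  shows "C_k (Suc n) f"
  using assms by (intro C_k_SucI[where f' = "\<lambda>x h. f' x * h"]) (auto simp: has_field_derivative_def)

lemma C_k_Suc_has_derivative:
  "C_k (Suc n) f \<Longrightarrow> (f has_derivative frechet_derivative f (at x)) (at x)"
  by (auto simp: frechet_derivative_works)

lemma C_k_Suc_D: "C_k (Suc n) f \<Longrightarrow> C_k n f"
proof (induction n arbitrary: f)
  case 0
  then show ?case
    by (simp add: continuous_on_eq_continuous_at differentiable_imp_continuous_within)
next
  case (Suc n)
  then show ?case by (metis C_k.simps(2))
qed

lemma C_k_const: "C_k n (\<lambda>x. c)"
proof (induction n arbitrary: c)
  case (Suc n)
  then show ?case by (intro C_k_SucI[where f' = "\<lambda>x h. 0"]) auto
qed auto

lemma C_k_linear: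
  assumes "bounded_linear f"
  shows "C_k n f"
proof (cases n)
  case 0
  then show ?thesis using assms linear_continuous_on by auto
next
  case (Suc m)
  show ?thesis
    unfolding Suc by (rule C_k_SucI[where f' = "\<lambda>x. f"])
      (use bounded_linear_imp_has_derivative[OF assms] C_k_const in auto)
qed

lemma C_k_add: "C_k n f \<Longrightarrow> C_k n g \<Longrightarrow> C_k n (\<lambda>x. f x + g x)"
proof (induction n arbitrary: f g)
  case 0
  then show ?case by (simp add: continuous_on_add)
next
  case (Suc n)
  show ?case
    by (rule C_k_SucI[OF has_derivative_add[OF C_k_Suc_has_derivative[OF Suc.prems(1)]
            C_k_Suc_has_derivative[OF Suc.prems(2)]]])
       (use Suc in auto)
qed

lemma C_k_mult: "C_k n f \<Longrightarrow> C_k n g \<Longrightarrow> C_k n (\<lambda>x. f x * g x)"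
proof (induction n arbitrary: f g)
  case 0
  then show ?case by (simp add: continuous_on_mult)
next
  case (Suc n)
  note fg = C_k_Suc_D[OF Suc.prems(1)] C_k_Suc_D[OF Suc.prems(2)]
  show ?case
    by (rule C_k_SucI[OF has_derivative_mult[OF C_k_Suc_has_derivative[OF Suc.prems(1)]
            C_k_Suc_has_derivative[OF Suc.prems(2)]]])
       (intro C_k_add Suc.IH, use Suc.prems fg in auto)
qed

text \<open>A derivative of the composite is a derivative of \<open>f\<close> times the composite of
  \<open>?h'\<close> with \<open>f\<close>. Hence the induction must let both functions vary and
  relies on closure under products.\<close>

lemma C_k_compose:
  fixes h :: "real \<Rightarrow> real"
  shows "C_k n h \<Longrightarrow> C_k n f \<Longrightarrow> C_k n (\<lambda>x. h (f x))"
proof (induction n arbitrary: h f)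
  case 0
  then show ?case using continuous_on_compose2[of UNIV h UNIV f] by simp
next
  case (Suc n)
  let ?h' = "\<lambda>y. frechet_derivative h (at y) 1"
  have h': "frechet_derivative h (at y) s = s * ?h' y" for y s
    using linear_cmul[OF has_derivative_linear[OF C_k_Suc_has_derivative[OF Suc.prems(1)]], of y s 1]
    by simp
  show ?case
  proof (rule C_k_SucI)
    show "((\<lambda>x. h (f x)) has_derivative (\<lambda>s. frechet_derivative f (at x) s * ?h' (f x))) (at x)" for x
      using has_derivative_compose[OF C_k_Suc_has_derivative[OF Suc.prems(2)]
          C_k_Suc_has_derivative[OF Suc.prems(1)]] by (subst h'[symmetric])
    show "C_k n (\<lambda>x. frechet_derivative f (at x) b * ?h' (f x))" if "b \<in> Basis" for b
      using that Suc.prems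
      by (intro C_k_mult Suc.IH[of ?h' f] C_k_Suc_D[OF Suc.prems(2)]) simp_all
  qed
qed

lemma smooth_const: "smooth (\<lambda>x. c)"
  unfolding smooth_def by (rule allI, rule C_k_const)

lemma smooth_linear: "bounded_linear f \<Longrightarrow> smooth f"
  unfolding smooth_def by (rule allI, rule C_k_linear)

lemma smooth_add: "smooth f \<Longrightarrow> smooth g \<Longrightarrow> smooth (\<lambda>x. f x + g x)"
  unfolding smooth_def by (rule allI, rule C_k_add; erule spec)

lemma smooth_mult: "smooth f \<Longrightarrow> smooth g \<Longrightarrow> smooth (\<lambda>x. f x * g x)"
  unfolding smooth_def by (rule allI, rule C_k_mult; erule spec)

lemma smooth_compose:
  fixes h :: "real \<Rightarrow> real"
  assumes "smooth h" "smooth f"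
  shows "smooth (\<lambda>x. h (f x))"
  using assms C_k_compose[of _ h f] unfolding smooth_def by metis

section \<open>Smooth functions of one variable: shifted powers, arctangent, flat functions\<close>

lemma DERIV_powr_shifted_square:
  fixes c :: real
  assumes "c > 0"
  shows "((\<lambda>t. (c + t\<^sup>2) powr p) has_real_derivative 2 * p * t * (c + t\<^sup>2) powr (p - 1)) (at t)"
proof -
  have "((\<lambda>t. c + t\<^sup>2) has_real_derivative 2 * t) (at t)"
    by (auto intro!: derivative_eq_intros)
  moreover have "c + t\<^sup>2 > 0" using assms by (simp add: add_pos_nonneg)
  ultimately show ?thesis
    using DERIV_chain2[OF has_real_derivative_powr, of "\<lambda>t. c + t\<^sup>2" t "2 * t" UNIV p]
    by (simp add: mult_ac)
qed

text \<open>Differentiation multiplies by a linear function and lowers the exponent by one, so the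
  family over all \<open>p\<close> is closed and the induction keeps \<open>p\<close> arbitrary.
  Exponent -1 is the derivative of \<open>arctan\<close>; exponent -1/2 is the smooth substitute for
  1/|t|.\<close>

lemma smooth_powr_shifted_square:
  fixes c :: real
  assumes "c > 0"
  shows "smooth (\<lambda>t. (c + t\<^sup>2) powr p)"
proof -
  have "C_k n (\<lambda>t. (c + t\<^sup>2) powr p)" for n p
  proof (induction n arbitrary: p)
    case 0
    show ?case
      using DERIV_continuous_on[OF has_field_derivative_at_within[OF DERIV_powr_shifted_square[OF assms]]]
      by simp
  next
    case (Suc n)
    have "C_k n (\<lambda>t. (2 * p * t) * (c + t\<^sup>2) powr (p - 1))"
      by (intro C_k_mult[OF C_k_linear[OF bounded_linear_mult_right] Suc])
    then show ?case by (rule C_k_Suc_real_I[OF DERIV_powr_shifted_square[OF assms]])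
  qed
  then show ?thesis by (simp add: smooth_def)
qed

lemma smooth_arctan: "smooth (arctan :: real \<Rightarrow> real)"
  unfolding smooth_def
proof
  fix n
  have "C_k n (\<lambda>t::real. (1 + t\<^sup>2) powr (-1))"
    using smooth_powr_shifted_square[of 1 "-1"] by (auto simp: smooth_def)
  moreover have "(arctan has_real_derivative (1 + t\<^sup>2) powr (-1)) (at t)" for t :: real
    using DERIV_arctan[of t] by (simp add: powr_minus add_nonneg_pos)
  ultimately show "C_k n (arctan :: real \<Rightarrow> real)"
    by (rule C_k_Suc_D[OF C_k_Suc_real_I, rotated])
qed

text \<open>\<open>flat 0\<close> is the classical smooth function exp(-1/t) that vanishes for t
  \<le> 0. The extra powers of 1/t make the span of the family closed under differentiation.\<close>

definition flat :: "nat \<Rightarrow> real \<Rightarrow> real" where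
  "flat k t = (if t > 0 then inverse t ^ k * exp (- inverse t) else 0)"

lemma flat_tendsto_0: "(flat k \<longlongrightarrow> 0) (at_right 0)"
proof -
  have "((\<lambda>t::real. inverse t ^ k / exp (inverse t)) \<longlongrightarrow> 0) (at_right 0)"
    by (rule filterlim_compose[OF tendsto_power_div_exp_0 filterlim_inverse_at_top_right])
  then show ?thesis
    by (rule tendsto_cong[THEN iffD1, rotated])
       (auto simp: flat_def eventually_at_filter exp_minus field_simps)
qed

lemma DERIV_flat: "(flat k has_real_derivative flat (k + 2) t - k * flat (k + 1) t) (at t)"
proof (cases "t = 0")
  case True
  have "((\<lambda>h. flat k h / h) \<longlongrightarrow> 0) (at_left 0)"
    by (rule tendsto_eventually) (auto simp: flat_def eventually_at_filter)
  \<comment> \<open>For h > 0 the difference quotient at 0 is again a member of the family,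
    \<open>flat (Suc k) h\<close>.\<close>
  moreover have "((\<lambda>h. flat k h / h) \<longlongrightarrow> 0) (at_right 0)"
    using flat_tendsto_0[of "Suc k"]
    by (rule tendsto_cong[THEN iffD1, rotated])
       (auto simp: flat_def eventually_at_filter field_simps)
  ultimately have "((\<lambda>h. flat k h / h) \<longlongrightarrow> 0) (at 0)"
    by (simp add: filterlim_split_at)
  then show ?thesis using True by (simp add: DERIV_def flat_def)
next
  case False
  show ?thesis
  proof (cases "t > 0")
    case True
    have "((\<lambda>t. inverse t ^ k) has_real_derivative - k * inverse t ^ (k + 1)) (at t)"
      using True DERIV_power[OF DERIV_inverse[of t UNIV], of k]
      by (cases k) (auto simp: power2_eq_square algebra_simps)
    moreover have "((\<lambda>t. exp (- inverse t)) has_real_derivative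
        inverse t ^ 2 * exp (- inverse t)) (at t)"
      using True by (auto intro!: derivative_eq_intros simp: power2_eq_square)
    ultimately have "((\<lambda>t. inverse t ^ k * exp (- inverse t)) has_real_derivative
        flat (k + 2) t - k * flat (k + 1) t) (at t)"
      using True by (auto dest: DERIV_mult simp: flat_def algebra_simps power2_eq_square)
    then show ?thesis
      by (rule has_field_derivative_transform_within_open[of _ _ _ "{0<..}"])
         (use True in \<open>auto simp: flat_def\<close>)
  next
    case neg: False
    have "((\<lambda>t. 0) has_real_derivative flat (k + 2) t - k * flat (k + 1) t) (at t)"
      using neg by (auto simp: flat_def)
    then show ?thesis
      by (rule has_field_derivative_transform_within_open[of _ _ _ "{..<0}"])
         (use neg False in \<open>auto simp: flat_def\<close>)
  qed
qed

lemma smooth_flat: "smooth (flat k)"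
proof -
  have "C_k n (flat k)" for n k
  proof (induction n arbitrary: k)
    case 0
    show ?case
      using DERIV_continuous_on[OF has_field_derivative_at_within[OF DERIV_flat]] by simp
  next
    case (Suc n)
    have "C_k n (\<lambda>t. flat (k + 2) t + - real k * flat (k + 1) t)"
      by (intro C_k_add C_k_mult C_k_const Suc)
    then show ?case by (intro C_k_Suc_real_I[OF DERIV_flat]) simp
  qed
  then show ?thesis by (simp add: smooth_def)
qed

section \<open>Integrability of weakly singular kernels\<close>

lemma integrable_abs_powr_Icc:
  fixes a S :: real
  assumes a: "a > -1"
  shows "integrable lborel (\<lambda>t. indicator {-S..S} t * \<bar>t\<bar> powr a)"
proof -
  have half: "integrable lborel (\<lambda>t. indicator {0..S} t * \<bar>t\<bar> powr a)"
  proof (cases "S \<ge> 0")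
    case True
    have "(\<lambda>t. t powr a) absolutely_integrable_on {0..S}"
      using has_integral_powr_from_0[OF a True]
      by (intro nonnegative_absolutely_integrable_1) (auto simp: integrable_on_def)
    then have "integrable lebesgue (\<lambda>t. indicator {0..S} t * \<bar>t\<bar> powr a)"
      unfolding set_integrable_def
      by (rule Bochner_Integration.integrable_cong[THEN iffD1, OF refl, rotated]) (auto split: split_indicator)
    then show ?thesis
      by (subst (asm) integrable_completion) auto
  qed auto
  have "integrable lborel (\<lambda>t. indicator {0..S} (0 + (-1) * t) * \<bar>0 + (-1) * t\<bar> powr a)"
    by (rule lborel_integrable_real_affine[OF half]) simp
  then have "integrable lborel (\<lambda>t. indicator {0..S} (-t) * \<bar>t\<bar> powr a + indicator {0..S} t * \<bar>t\<bar> powr a)"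
    using half by simp
  then show ?thesis
    by (rule Bochner_Integration.integrable_bound) (auto split: split_indicator)
qed

lemma integrable_lborel_prod_mult:
  fixes g h :: "real \<Rightarrow> real"
  assumes g: "integrable lborel g" and h: "integrable lborel h"
  shows "integrable lborel (\<lambda>z. g (fst z) * h (snd z))"
proof -
  have [measurable]: "g \<in> borel_measurable borel" "h \<in> borel_measurable borel"
    using g h by (simp_all add: borel_measurable_integrable)
  have "integrable (lborel \<Otimes>\<^sub>M lborel) (\<lambda>z. g (fst z) * h (snd z))"
  proof (rule lborel_pair.Fubini_integrable)
    show "integrable lborel (\<lambda>x. LINT y|lborel. norm (g (fst (x, y)) * h (snd (x, y))))"
      using g by (simp add: abs_mult)
    show "AE x in lborel. integrable lborel (\<lambda>y. g (fst (x, y)) * h (snd (x, y)))"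
      using h by simp
  qed measurable
  then show ?thesis by (simp add: lborel_prod)
qed

definition box_of :: "real \<Rightarrow> (real \<times> real) set" where
  "box_of S = {-S..S} \<times> {-S..S}"

lemma mem_box_of: "z \<in> box_of S \<longleftrightarrow> \<bar>fst z\<bar> \<le> S \<and> \<bar>snd z\<bar> \<le> S"
  by (cases z) (auto simp: box_of_def)

lemma box_of_borel [measurable]: "box_of S \<in> sets borel"
  by (simp add: box_of_def borel_Times)

lemma AE_lborel_plane_coords: "AE z in (lborel :: (real \<times> real) measure). fst z \<noteq> 0 \<and> snd z \<noteq> 0"
proof -
  have "AE z in (lborel :: real measure) \<Otimes>\<^sub>M (lborel :: real measure). fst z \<noteq> 0 \<and> snd z \<noteq> 0"
  proof (rule lborel_pair.AE_pair_measure)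
    show "AE x in lborel. AE y in lborel. fst (x, y) \<noteq> (0::real) \<and> snd (x, y) \<noteq> (0::real)"
      using AE_lborel_singleton[of "0::real"] by eventually_elim (use AE_lborel_singleton[of "0::real"] in auto)
  qed measurable
  then show ?thesis by (simp only: lborel_prod)
qed

text \<open>The exponent must lie above -2 to be integrable in the plane and below -1 to dominate
  the kernel with half a power to spare. That spare half power is what pays for the factor sqrt
  |x_2| in the bound on u^2.\<close>

definition sing_majorant :: "real \<Rightarrow> real \<times> real \<Rightarrow> real" where
  "sing_majorant S z = indicator (box_of S) z * norm z powr (- 3 / 2)"

lemma sing_majorant_nonneg: "sing_majorant S z \<ge> 0"
  by (simp add: sing_majorant_def)

lemma sing_majorant_borel [measurable]: "sing_majorant S \<in> borel_measurable borel"
  unfolding sing_majorant_def by measurable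

text \<open>Since |x| |y| \<le> |z|^2 for z = (x, y), the singularity |z|^(-3/2) is at most
  |x|^(-3/4) |y|^(-3/4), a product of two integrable functions of one variable.\<close>

lemma integrable_sing_majorant: "integrable lborel (sing_majorant S)"
proof -
  let ?a = "\<lambda>t::real. indicator {-S..S} t * \<bar>t\<bar> powr (- 3 / 4)"
  have "integrable lborel (\<lambda>z. ?a (fst z) * ?a (snd z))"
    by (intro integrable_lborel_prod_mult integrable_abs_powr_Icc) simp_all
  then show ?thesis
  proof (rule Bochner_Integration.integrable_bound)
    show "AE z in lborel. norm (sing_majorant S z) \<le> norm (?a (fst z) * ?a (snd z))"
      using AE_lborel_plane_coords
    proof eventually_elim
      case (elim z)
      obtain x y where z: "z = (x, y)" by (cases z)
      have xy: "x \<noteq> 0" "y \<noteq> 0" using elim z by auto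
      have "(\<bar>x\<bar> * \<bar>y\<bar>) powr (1/2) \<le> norm z"
      proof -
        have "2 * (\<bar>x\<bar> * \<bar>y\<bar>) \<le> x\<^sup>2 + y\<^sup>2"
          using sum_squares_bound[of "\<bar>x\<bar>" "\<bar>y\<bar>"] by (simp add: mult.assoc)
        moreover have "0 \<le> \<bar>x\<bar> * \<bar>y\<bar>" by (intro mult_nonneg_nonneg) auto
        ultimately have "\<bar>x\<bar> * \<bar>y\<bar> \<le> x\<^sup>2 + y\<^sup>2" by linarith
        then show ?thesis
          by (simp add: z norm_Pair powr_half_sqrt)
      qed
      moreover have "(\<bar>x\<bar> * \<bar>y\<bar>) powr (1/2) > 0" using xy by simp
      ultimately have "norm z powr (- 3 / 2) \<le> ((\<bar>x\<bar> * \<bar>y\<bar>) powr (1/2)) powr (- 3 / 2)"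
        by (intro powr_mono2') auto
      also have "\<dots> = \<bar>x\<bar> powr (- 3 / 4) * \<bar>y\<bar> powr (- 3 / 4)"
        by (simp add: powr_powr powr_mult)
      finally show ?case
        by (auto simp: sing_majorant_def z box_of_def abs_mult split: split_indicator)
    qed
  qed measurable
qed

lemma inverse_norm_le_sing_majorant:
  assumes "z \<in> box_of S"
  shows "inverse (norm z) \<le> sqrt (2 * S) * sing_majorant S z"
proof (cases "z = 0")
  case False
  have "norm z \<le> norm (fst z) + norm (snd z)"
    using norm_Pair_le[of "fst z" "snd z"] by simp
  then have "norm z \<le> 2 * S" using assms by (simp add: mem_box_of)
  then have "sqrt (norm z) * norm z powr (- 3 / 2) \<le> sqrt (2 * S) * norm z powr (- 3 / 2)"
    by (intro mult_right_mono) auto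
  moreover have "sqrt (norm z) * norm z powr (- 3 / 2) = inverse (norm z)"
    using False powr_add[of "norm z" "1 / 2" "- 3 / 2"]
    by (simp add: powr_half_sqrt powr_minus)
  ultimately show ?thesis using assms by (simp add: sing_majorant_def)
qed (use assms in \<open>auto simp: sing_majorant_nonneg mem_box_of\<close>)

text \<open>Both factors of the affine map have modulus 1, so its Jacobian is 1. The four sign
  choices cover every change of variables in the plane used below: translations, y \<mapsto> x - y,
  and reflections in horizontal and vertical lines.\<close>

lemma
  fixes g :: "real \<times> real \<Rightarrow> 'a::{banach, second_countable_topology}" and s :: "real \<times> real"
  assumes s: "\<bar>fst s\<bar> = 1" "\<bar>snd s\<bar> = 1" and g: "g \<in> borel_measurable borel"
  shows integral_plane_rigid:
      "(LINT y|lborel. g (fst c + fst s * fst y, snd c + snd s * snd y)) = (LINT y|lborel. g y)"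
    and integrable_plane_rigid:
      "integrable lborel (\<lambda>y. g (fst c + fst s * fst y, snd c + snd s * snd y)) \<longleftrightarrow> integrable lborel g"
proof -
  let ?T = "\<lambda>y. (fst c + fst s * fst y, snd c + snd s * snd y)"
  have T[measurable]: "?T \<in> borel \<rightarrow>\<^sub>M borel" by (intro borel_measurable_continuous_onI continuous_intros)
  define C where "C = (\<lambda>j::real\<times>real. if j = (1,0) then fst s else snd s)"
  have "lborel = density (distr lborel borel (\<lambda>x. c + (\<Sum>j\<in>Basis. (C j * (x \<bullet> j)) *\<^sub>R j)))
      (\<lambda>_. (\<Prod>j\<in>Basis. \<bar>C j\<bar>))"
    by (rule lborel_affine_euclidean) (use s in \<open>auto simp: C_def\<close>)
  also have "(\<lambda>x. c + (\<Sum>j\<in>Basis. (C j * (x \<bullet> j)) *\<^sub>R j)) = ?T"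
    by (auto simp: Basis_prod_def C_def sum.union_disjoint prod_eq_iff)
  also have "(\<Prod>j\<in>Basis. \<bar>C j\<bar>) = 1"
    using s by (intro prod.neutral) (auto simp: C_def)
  finally have eq: "lborel = distr lborel borel ?T"
    by (simp add: density_1)
  have g': "g \<in> borel_measurable (distr lborel borel ?T)" using g by simp
  show "(LINT y|lborel. g (?T y)) = (LINT y|lborel. g y)"
    by (subst (2) eq, subst integral_distr) (use g in auto)
  show "integrable lborel (\<lambda>y. g (?T y)) \<longleftrightarrow> integrable lborel g"
    by (subst (2) eq, subst integrable_distr_eq) (use g in auto)
qed

text \<open>A nonempty open set is not null. Every strict inequality between integrals below is
  drawn from this: the mass of \<open>bump\<close>, the sign of u^2, the sign of B and the final
  gap.\<close>

lemma integral_pos_if_open: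
  fixes g :: "'a::euclidean_space \<Rightarrow> real"
  assumes g: "integrable lborel g" "\<And>x. g x \<ge> 0"
    and V: "open V" "V \<noteq> {}" "\<And>x. x \<in> V \<Longrightarrow> g x > 0"
  shows "(LINT x|lborel. g x) > 0"
proof (rule ccontr)
  assume "\<not> ?thesis"
  moreover have "(LINT x|lborel. g x) \<ge> 0" using g by simp
  ultimately have "(LINT x|lborel. g x) = 0" by linarith
  then have "AE x in lborel. g x = 0" using integral_nonneg_eq_0_iff_AE[OF g(1)] g(2) by simp
  then have "AE x in lborel. x \<notin> V"
    by eventually_elim (use V in force)
  then have "emeasure lborel V = 0"
    using V(1) by (subst (asm) AE_iff_measurable[of V]) auto
  moreover have "emeasure lborel V \<noteq> 0"
    using open_not_negligible[OF V(1,2)] V(1) 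
    by (auto simp: negligible_iff_emeasure0)
  ultimately show False by simp
qed

section \<open>The velocity of an odd vorticity\<close>

lemma fst_borel_measurable [measurable (raw)]:
  fixes g :: "'a \<Rightarrow> real \<times> real"
  shows "g \<in> borel_measurable M \<Longrightarrow> (\<lambda>x. fst (g x)) \<in> borel_measurable M"
  using measurable_compose[of g M borel fst borel] by (simp add: borel_measurable_continuous_onI continuous_intros)

lemma snd_borel_measurable [measurable (raw)]:
  fixes g :: "'a \<Rightarrow> real \<times> real"
  shows "g \<in> borel_measurable M \<Longrightarrow> (\<lambda>x. snd (g x)) \<in> borel_measurable M"
  using measurable_compose[of g M borel snd borel] by (simp add: borel_measurable_continuous_onI continuous_intros)

section \<open>The Biot-Savart kernel and its difference under reflection\<close>

lemma inner_biot_savart: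
  "biot_savart z \<bullet> w = (fst z * snd w - snd z * fst w) / (2 * pi * (norm z)\<^sup>2)"
  by (cases z; cases w) (simp add: biot_savart_def algebra_simps diff_divide_distrib)

lemma fst_biot_savart: "fst (biot_savart z) = - snd z / (2 * pi * (norm z)\<^sup>2)"
  and snd_biot_savart: "snd (biot_savart z) = fst z / (2 * pi * (norm z)\<^sup>2)"
  by (simp_all add: biot_savart_def)

lemma norm_biot_savart: "norm (biot_savart z) = inverse (norm z) / (2 * pi)"
proof -
  have "norm (- snd z, fst z) = norm z"
    by (cases z) (simp add: norm_Pair add.commute)
  then show ?thesis
    by (simp add: biot_savart_def power2_eq_square divide_simps del: scaleR_Pair)
qed

lemma norm_biot_savart_le: "norm (biot_savart z) \<le> inverse (norm z)"
proof -
  have "inverse (norm z) / (2 * pi) \<le> inverse (norm z) / 1"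
    using pi_gt3 by (intro divide_left_mono) auto
  then show ?thesis by (simp add: norm_biot_savart)
qed

lemma biot_savart_borel [measurable]: "biot_savart \<in> borel_measurable borel"
proof -
  have "(\<lambda>x::real\<times>real. (- snd x, fst x)) \<in> borel_measurable borel"
    by (intro borel_measurable_continuous_onI continuous_intros)
  then show ?thesis unfolding biot_savart_def by measurable
qed

lemma integrable_sing_majorant_shift: "integrable lborel (\<lambda>y. sing_majorant S (x - y))"
  and integral_sing_majorant_shift:
    "(LINT y|lborel. sing_majorant S (x - y)) = (LINT y|lborel. sing_majorant S y)"
proof -
  have eq: "(fst x + fst (-1, -1) * fst y, snd x + snd (-1, -1) * snd y) = x - y" for y :: "real \<times> real"
    by (simp add: prod_eq_iff)
  show "integrable lborel (\<lambda>y. sing_majorant S (x - y))"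
    using integrable_plane_rigid[of "(-1,-1)" "sing_majorant S" x] integrable_sing_majorant
    unfolding eq by simp
  show "(LINT y|lborel. sing_majorant S (x - y)) = (LINT y|lborel. sing_majorant S y)"
    using integral_plane_rigid[of "(-1,-1)" "sing_majorant S" x] unfolding eq by simp
qed

lemma integral_reflect_snd:
  fixes g :: "real \<times> real \<Rightarrow> 'a::{banach, second_countable_topology}"
  assumes "g \<in> borel_measurable borel"
  shows "(LINT y|lborel. g (fst y, - snd y)) = (LINT y|lborel. g y)"
  using integral_plane_rigid[of "(1,-1)" g "(0,0)"] assms by simp

lemma powr_minus_3_2: "m > 0 \<Longrightarrow> m powr (- 3 / 2) = 1 / (m * sqrt m)" for m :: real
  using powr_add[of m 1 "1/2"] by (simp add: powr_minus_divide powr_half_sqrt)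

text \<open>Here \<open>t\<close> is the horizontal offset, \<open>p\<close> and \<open>q\<close>
  are the heights, and \<open>m1\<close>, \<open>m2\<close> the distances to a point and to its
  mirror image. The difference equals 4 t p q / (m1^2 m2^2). One estimates |t| by m1 and |q| by m2,
  but |p| only by sqrt |p| sqrt m2: half a power of the height is kept, the other half softens the
  singularity to m1^(-3/2).\<close>

lemma image_kernel_bound_aux:
  fixes t p q :: real
  defines "m1 \<equiv> sqrt (t\<^sup>2 + (p - q)\<^sup>2)" and "m2 \<equiv> sqrt (t\<^sup>2 + (p + q)\<^sup>2)"
  assumes t: "t \<noteq> 0" and le: "m1 \<le> m2"
  shows "\<bar>t / m1\<^sup>2 - t / m2\<^sup>2\<bar> \<le> 4 * sqrt \<bar>p\<bar> * m1 powr (- 3 / 2)"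
proof -
  have pos: "m1 > 0" "m2 > 0" using t by (auto simp: m1_def m2_def sum_power2_gt_zero_iff)
  have sq: "m1\<^sup>2 = t\<^sup>2 + (p - q)\<^sup>2" "m2\<^sup>2 = t\<^sup>2 + (p + q)\<^sup>2" by (simp_all add: m1_def m2_def)
  have "(p - q)\<^sup>2 \<le> (p + q)\<^sup>2" using le by (simp add: m1_def m2_def)
  then have "\<bar>p - q\<bar> \<le> \<bar>p + q\<bar>" by (simp add: abs_le_square_iff)
  moreover have "\<bar>p + q\<bar> \<le> m2" unfolding m2_def by (rule real_le_rsqrt) simp
  ultimately have p: "\<bar>p\<bar> \<le> m2" and q: "\<bar>q\<bar> \<le> m2" by linarith+
  have tm: "\<bar>t\<bar> \<le> m1" unfolding m1_def by (rule real_le_rsqrt) simp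
  have "t / m1\<^sup>2 - t / m2\<^sup>2 = t * (m2\<^sup>2 - m1\<^sup>2) / (m1\<^sup>2 * m2\<^sup>2)"
    using pos by (simp add: field_simps)
  also have "m2\<^sup>2 - m1\<^sup>2 = 4 * p * q" unfolding sq by (simp add: power2_eq_square algebra_simps)
  finally have "\<bar>t / m1\<^sup>2 - t / m2\<^sup>2\<bar> = 4 * (\<bar>t\<bar> * (\<bar>p\<bar> * \<bar>q\<bar>)) / (m1\<^sup>2 * m2\<^sup>2)"
    by (simp add: abs_mult)
  also have "\<dots> \<le> 4 * (m1 * ((sqrt \<bar>p\<bar> * sqrt m2) * m2)) / (m1\<^sup>2 * m2\<^sup>2)"
  proof -
    have "\<bar>p\<bar> = sqrt \<bar>p\<bar> * sqrt \<bar>p\<bar>" by simp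
    also have "\<dots> \<le> sqrt \<bar>p\<bar> * sqrt m2" using p by (intro mult_left_mono) auto
    finally have "\<bar>t\<bar> * (\<bar>p\<bar> * \<bar>q\<bar>) \<le> m1 * ((sqrt \<bar>p\<bar> * sqrt m2) * m2)"
      using tm q pos by (intro mult_mono) auto
    then show ?thesis by (intro divide_right_mono) auto
  qed
  also have "\<dots> = 4 * sqrt \<bar>p\<bar> / (m1 * sqrt m2)"
    using pos real_sqrt_mult_self[of m2]
    by (simp add: divide_simps power2_eq_square del: real_sqrt_mult_self)
  also have "\<dots> \<le> 4 * sqrt \<bar>p\<bar> / (m1 * sqrt m1)"
    using le pos by (intro divide_left_mono mult_left_mono) auto
  finally show ?thesis unfolding powr_minus_3_2[OF pos(1)] by simp
qed

lemma image_kernel_bound: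
  fixes x y :: "real \<times> real"
  shows "\<bar>snd (biot_savart (x - y)) - snd (biot_savart ((fst x, - snd x) - y))\<bar>
    \<le> 4 * sqrt \<bar>snd x\<bar> * (norm (x - y) powr (- 3 / 2) + norm ((fst x, - snd x) - y) powr (- 3 / 2))"
proof -
  obtain a p b q where xy: "x = (a, p)" "y = (b, q)" by (cases x; cases y)
  define t where "t = a - b"
  define m1 m2 where "m1 = sqrt (t\<^sup>2 + (p - q)\<^sup>2)" and "m2 = sqrt (t\<^sup>2 + (p + q)\<^sup>2)"
  have n: "norm (x - y) = m1" "norm ((fst x, - snd x) - y) = m2"
    by (simp_all add: xy norm_Pair m1_def m2_def t_def power2_commute[of "- p" q] add.commute)
  have "\<bar>t / m1\<^sup>2 - t / m2\<^sup>2\<bar> \<le> 4 * sqrt \<bar>p\<bar> * (m1 powr (- 3 / 2) + m2 powr (- 3 / 2))"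
  proof (cases "t = 0")
    case False
    show ?thesis
    proof (cases "m1 \<le> m2")
      case True
      then have "\<bar>t / m1\<^sup>2 - t / m2\<^sup>2\<bar> \<le> 4 * sqrt \<bar>p\<bar> * m1 powr (- 3 / 2)"
        using image_kernel_bound_aux[OF False, of p q] by (simp add: m1_def m2_def)
      also have "\<dots> \<le> 4 * sqrt \<bar>p\<bar> * (m1 powr (- 3 / 2) + m2 powr (- 3 / 2))"
        by (intro mult_left_mono) auto
      finally show ?thesis .
    next
      case m: False
      \<comment> \<open>Replacing \<open>q\<close> by \<open>-q\<close> exchanges \<open>m1\<close>
        and \<open>m2\<close>.\<close>
      then have "\<bar>t / m2\<^sup>2 - t / m1\<^sup>2\<bar> \<le> 4 * sqrt \<bar>p\<bar> * m2 powr (- 3 / 2)"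
        using image_kernel_bound_aux[OF False, of p "-q"] by (simp add: m1_def m2_def)
      also have "\<dots> \<le> 4 * sqrt \<bar>p\<bar> * (m1 powr (- 3 / 2) + m2 powr (- 3 / 2))"
        by (intro mult_left_mono) auto
      finally show ?thesis by (simp add: abs_minus_commute)
    qed
  qed auto
  moreover have "\<bar>snd (biot_savart (x - y)) - snd (biot_savart ((fst x, - snd x) - y))\<bar>
      = \<bar>t / m1\<^sup>2 - t / m2\<^sup>2\<bar> / (2 * pi)"
  proof -
    have k: "snd (biot_savart (x - y)) = t / m1\<^sup>2 / (2 * pi)"
      "snd (biot_savart ((fst x, - snd x) - y)) = t / m2\<^sup>2 / (2 * pi)"
      unfolding snd_biot_savart n by (simp_all add: xy t_def)
    show ?thesis unfolding k diff_divide_distrib[symmetric] by (simp add: abs_divide)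
  qed
  moreover have "\<bar>t / m1\<^sup>2 - t / m2\<^sup>2\<bar> / (2 * pi) \<le> \<bar>t / m1\<^sup>2 - t / m2\<^sup>2\<bar> / 1"
    using pi_gt3 by (intro divide_left_mono) auto
  ultimately show ?thesis unfolding n by (simp add: xy)
qed

text \<open>These properties carry the velocity estimates, the symmetrized identity and the weak
  identity. The shape of \<Omega> enters only later, for signs.\<close>

locale odd_vorticity =
  fixes f :: "real \<times> real \<Rightarrow> real" and R :: real
  assumes f_borel [measurable]: "f \<in> borel_measurable borel"
    and f_le_1: "\<bar>f x\<bar> \<le> 1"
    and f_supp: "f x \<noteq> 0 \<Longrightarrow> x \<in> box_of R"
    and f_odd: "f (a, - b) = - f (a, b)"
begin

definition u :: "real \<times> real \<Rightarrow> real \<times> real" where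
  "u = convolution biot_savart f"

lemma abs_f_inverse_norm_le:
  assumes "x \<in> box_of T"
  shows "\<bar>f y\<bar> * inverse (norm (x - y)) \<le> sqrt (2 * (T + R)) * sing_majorant (T + R) (x - y)"
proof (cases "f y = 0")
  case True
  \<comment> \<open>\<open>sqrt\<close> is negative at negative arguments, but then the box is empty
    and the majorant vanishes.\<close>
  have "sing_majorant (T + R) (x - y) = 0" if "T + R < 0"
    using that by (auto simp: sing_majorant_def mem_box_of indicator_def)
  then show ?thesis
    using True sing_majorant_nonneg[of "T + R" "x - y"]
    by (cases "T + R < 0") auto
next
  case False
  then have "x - y \<in> box_of (T + R)" using f_supp[of y] assms by (auto simp: mem_box_of)
  have "\<bar>f y\<bar> * inverse (norm (x - y)) \<le> 1 * inverse (norm (x - y))"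
    by (intro mult_right_mono f_le_1) auto
  then show ?thesis using inverse_norm_le_sing_majorant[OF \<open>x - y \<in> _\<close>] by simp
qed

lemma mem_box_of_norm: "x \<in> box_of (norm x)" for x :: "real \<times> real"
  using norm_fst_le[of "fst x" "snd x"] norm_snd_le[of "snd x" "fst x"] by (simp add: mem_box_of)

lemma integrable_f_inverse_norm: "integrable lborel (\<lambda>y. \<bar>f y\<bar> * inverse (norm (x - y)))"
proof (rule Bochner_Integration.integrable_bound[OF integrable_mult_right[OF
        integrable_sing_majorant_shift[of "norm x + R" x], of "sqrt (2 * (norm x + R))"]])
  show "AE y in lborel. norm (\<bar>f y\<bar> * inverse (norm (x - y)))
      \<le> norm (sqrt (2 * (norm x + R)) * sing_majorant (norm x + R) (x - y))"
  proof (rule AE_I2)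
    fix y
    show "norm (\<bar>f y\<bar> * inverse (norm (x - y)))
      \<le> norm (sqrt (2 * (norm x + R)) * sing_majorant (norm x + R) (x - y))"
      using abs_f_inverse_norm_le[OF mem_box_of_norm, of y x]
        abs_ge_self[of "sqrt (2 * (norm x + R)) * sing_majorant (norm x + R) (x - y)"]
      unfolding real_norm_def abs_mult[of "\<bar>f y\<bar>"] abs_abs abs_inverse abs_norm_cancel by linarith
  qed
qed measurable

text \<open>A bound for \<integral> |f(y)| / |x - y| dy, and hence for |u(x)|, uniform over x in
  \<open>box_of R\<close>. The radius doubles because x - y is a difference of two points of that
  box.\<close>

definition potential_bound :: real where
  "potential_bound = sqrt (2 * (R + R)) * (LINT y|lborel. sing_majorant (R + R) y)"

lemma integral_f_inverse_norm_le:
  assumes "x \<in> box_of R"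
  shows "(LINT y|lborel. \<bar>f y\<bar> * inverse (norm (x - y))) \<le> potential_bound"
proof -
  have "(LINT y|lborel. \<bar>f y\<bar> * inverse (norm (x - y)))
      \<le> (LINT y|lborel. sqrt (2 * (R + R)) * sing_majorant (R + R) (x - y))"
    by (intro integral_mono integrable_f_inverse_norm abs_f_inverse_norm_le assms
        integrable_mult_right integrable_sing_majorant_shift)
  then show ?thesis by (simp add: potential_bound_def integral_sing_majorant_shift)
qed

lemma integrable_f: "integrable lborel f"
proof -
  have "integrable lborel (\<lambda>z. indicator {-R..R} (fst z) * indicator {-R..R} (snd z) :: real)"
    by (intro integrable_lborel_prod_mult integrable_real_indicator)
      (auto simp: emeasure_lborel_Icc_eq)
  then show ?thesis
  proof (rule Bochner_Integration.integrable_bound)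
    have "\<bar>f z\<bar> \<le> indicator {-R..R} (fst z) * indicator {-R..R} (snd z)" for z
      using f_supp[of z] f_le_1[of z] by (cases "f z = 0") (auto simp: mem_box_of indicator_def)
    then show "AE z in lborel. norm (f z) \<le> norm (indicator {-R..R} (fst z) * indicator {-R..R} (snd z) :: real)"
      by (auto intro: order_trans[OF _ abs_ge_self])
  qed measurable
qed

lemma integrable_u: "integrable lborel (\<lambda>y. f y *\<^sub>R biot_savart (x - y))"
  by (rule Bochner_Integration.integrable_bound[OF integrable_f_inverse_norm[of x]])
     (auto intro!: mult_left_mono norm_biot_savart_le)

lemma inner_u: "u x \<bullet> w = (LINT y|lborel. f y * (biot_savart (x - y) \<bullet> w))"
  using integral_inner_left[OF integrable_u[of x], of w] by (simp add: u_def convolution_def)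

lemma fst_u: "fst (u x) = (LINT y|lborel. f y * fst (biot_savart (x - y)))"
  using inner_u[of x "(1,0)"] by (simp add: inner_prod_def)

lemma snd_u: "snd (u x) = (LINT y|lborel. f y * snd (biot_savart (x - y)))"
  using inner_u[of x "(0,1)"] by (simp add: inner_prod_def)

lemma integrable_snd_u: "integrable lborel (\<lambda>y. f y * snd (biot_savart (x - y)))"
  using integrable_inner_left[OF integrable_u[of x], of "(0,1)"] by (simp add: inner_prod_def)

lemma u_borel [measurable]: "u \<in> borel_measurable borel"
proof -
  have "(\<lambda>x. LINT y|lborel. f y *\<^sub>R biot_savart (x - y)) \<in> borel_measurable lborel"
    by (rule lborel.borel_measurable_lebesgue_integral) measurable
  then show ?thesis by (simp add: u_def convolution_def[abs_def])
qed

lemma norm_u_le: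
  assumes "x \<in> box_of R"
  shows "norm (u x) \<le> potential_bound"
proof -
  have "norm (u x) \<le> (LINT y|lborel. norm (f y *\<^sub>R biot_savart (x - y)))"
    unfolding u_def convolution_def by (rule integral_norm_bound)
  also have "\<dots> \<le> (LINT y|lborel. \<bar>f y\<bar> * inverse (norm (x - y)))"
    by (intro integral_mono integrable_norm integrable_u integrable_f_inverse_norm)
      (auto intro!: mult_left_mono norm_biot_savart_le)
  also have "\<dots> \<le> potential_bound" by (rule integral_f_inverse_norm_le[OF assms])
  finally show ?thesis .
qed

text \<open>Reflecting both points keeps their horizontal offset and their distance, so the second
  kernel component is invariant and the sign comes from \<open>f\<close>. In particular u^2 vanishes
  on the axis.\<close>

lemma snd_u_reflect: "snd (u (a, - b)) = - snd (u (a, b))"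
proof -
  have "snd (u (a, - b)) = (LINT y|lborel. f (fst y, - snd y) * snd (biot_savart ((a, - b) - (fst y, - snd y))))"
    unfolding snd_u by (rule integral_reflect_snd[symmetric]) measurable
  also have "\<dots> = (LINT y|lborel. - (f y * snd (biot_savart ((a, b) - y))))"
  proof (rule Bochner_Integration.integral_cong[OF refl])
    fix y :: "real \<times> real"
    have "norm ((a, - b) - (fst y, - snd y)) = norm ((a, b) - y)"
      by (cases y) (simp add: norm_Pair power2_eq_square algebra_simps)
    then show "f (fst y, - snd y) * snd (biot_savart ((a, - b) - (fst y, - snd y)))
        = - (f y * snd (biot_savart ((a, b) - y)))"
      unfolding snd_biot_savart by (simp add: f_odd)
  qed
  also have "\<dots> = - snd (u (a, b))" by (simp add: snd_u)
  finally show ?thesis .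
qed

definition snd_bound :: real where
  "snd_bound = 4 * (LINT y|lborel. sing_majorant (R + R) y)"

text \<open>By oddness 2 u^2(x) is the difference of u^2 at x and at its mirror image, and the
  kernel difference is bounded by \<open>image_kernel_bound\<close>. This is the quantitative
  vanishing that offsets the factor 1/|x_2| of the smoothed jump.\<close>

lemma abs_snd_u_le:
  assumes x: "x \<in> box_of R"
  shows "\<bar>snd (u x)\<bar> \<le> snd_bound * sqrt \<bar>snd x\<bar>"
proof -
  define x' where "x' = (fst x, - snd x)"
  have x': "x' \<in> box_of R" using x by (simp add: x'_def mem_box_of)
  let ?N = "sing_majorant (R + R)"
  have "snd (u x') = - snd (u x)" using snd_u_reflect[of "fst x" "snd x"] by (simp add: x'_def)
  then have "2 * snd (u x) = (LINT y|lborel. f y * snd (biot_savart (x - y)) - f y * snd (biot_savart (x' - y)))"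
    using integrable_snd_u by (simp add: snd_u)
  also have "norm \<dots> \<le> (LINT y|lborel. norm (f y * snd (biot_savart (x - y)) - f y * snd (biot_savart (x' - y))))"
    by (rule integral_norm_bound)
  also have "\<dots> \<le> (LINT y|lborel. 4 * sqrt \<bar>snd x\<bar> * (?N (x - y) + ?N (x' - y)))"
  proof (rule integral_mono)
    show "integrable lborel (\<lambda>y. norm (f y * snd (biot_savart (x - y)) - f y * snd (biot_savart (x' - y))))"
      using integrable_snd_u by auto
    show "integrable lborel (\<lambda>y. 4 * sqrt \<bar>snd x\<bar> * (?N (x - y) + ?N (x' - y)))"
      using integrable_sing_majorant_shift by auto
    show "norm (f y * snd (biot_savart (x - y)) - f y * snd (biot_savart (x' - y)))
        \<le> 4 * sqrt \<bar>snd x\<bar> * (?N (x - y) + ?N (x' - y))" for y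
    proof (cases "f y = 0")
      case True
      then show ?thesis by (simp add: sing_majorant_nonneg)
    next
      case False
      then have "x - y \<in> box_of (R + R)" "x' - y \<in> box_of (R + R)"
        using f_supp[of y] x x' by (auto simp: mem_box_of)
      then have e: "4 * sqrt \<bar>snd x\<bar> * (?N (x - y) + ?N (x' - y))
          = 4 * sqrt \<bar>snd x\<bar> * (norm (x - y) powr (- 3 / 2) + norm (x' - y) powr (- 3 / 2))"
        by (simp add: sing_majorant_def)
      have le: "norm (f y * snd (biot_savart (x - y)) - f y * snd (biot_savart (x' - y)))
          \<le> \<bar>snd (biot_savart (x - y)) - snd (biot_savart (x' - y))\<bar>"
        unfolding right_diff_distrib[symmetric] real_norm_def abs_mult
        by (intro mult_left_le_one_le f_le_1) auto
      show ?thesis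
        unfolding e by (rule order_trans[OF le image_kernel_bound[of x y, folded x'_def]])
    qed
  qed
  also have "\<dots> = 8 * sqrt \<bar>snd x\<bar> * (LINT y|lborel. ?N y)"
    using integrable_sing_majorant_shift integral_sing_majorant_shift by simp
  finally show ?thesis by (simp add: snd_bound_def abs_mult algebra_simps)
qed

end

section \<open>The symmetrized identity\<close>

lemma coord_div_norm_sq_le: "\<bar>fst y\<bar> / (norm y)\<^sup>2 \<le> 1 / norm y" "\<bar>snd y\<bar> / (norm y)\<^sup>2 \<le> 1 / norm y"
  for y :: "real \<times> real"
  using norm_fst_le[of "fst y" "snd y"] norm_snd_le[of "snd y" "fst y"]
  by (auto simp: power2_eq_square divide_simps)

context odd_vorticity begin

definition axis_moment :: real where
  "axis_moment = (LINT y|lborel. f y * snd y / (norm y)\<^sup>2)"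

lemma integrable_f_div_norm: "integrable lborel (\<lambda>y. f y / norm y)"
  by (rule Bochner_Integration.integrable_bound[OF integrable_f_inverse_norm[of 0]])
     (auto simp: divide_inverse abs_mult)

lemma integrable_f_coord:
  "integrable lborel (\<lambda>y. f y * fst y / (norm y)\<^sup>2)"
  "integrable lborel (\<lambda>y. f y * snd y / (norm y)\<^sup>2)"
proof -
  have "\<bar>f y\<bar> * (\<bar>fst y\<bar> / (norm y)\<^sup>2) \<le> \<bar>f y\<bar> * (1 / norm y)"
    "\<bar>f y\<bar> * (\<bar>snd y\<bar> / (norm y)\<^sup>2) \<le> \<bar>f y\<bar> * (1 / norm y)" for y
    by (rule mult_left_mono[OF coord_div_norm_sq_le(1)], simp)
       (rule mult_left_mono[OF coord_div_norm_sq_le(2)], simp)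
  then show "integrable lborel (\<lambda>y. f y * fst y / (norm y)\<^sup>2)"
    "integrable lborel (\<lambda>y. f y * snd y / (norm y)\<^sup>2)"
    by (auto intro!: Bochner_Integration.integrable_bound[OF integrable_f_div_norm] AE_I2 simp: abs_mult)
qed

text \<open>The integrand is odd in the second coordinate. This removes the product of first
  coordinates from the symmetrized kernel.\<close>

lemma integral_f_fst_eq_0: "(LINT y|lborel. f y * fst y / (norm y)\<^sup>2) = 0"
proof -
  let ?g = "\<lambda>y. f y * fst y / (norm y)\<^sup>2"
  have "?g (fst y, - snd y) = - ?g y" for y
    by (cases y) (simp add: f_odd norm_Pair)
  then show ?thesis
    using integral_reflect_snd[of ?g] by simp
qed

lemma fst_u_0: "fst (u 0) = axis_moment / (2 * pi)"
proof -
  have "fst (u 0) = (LINT y|lborel. (f y * snd y / (norm y)\<^sup>2) / (2 * pi))"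
    unfolding fst_u fst_biot_savart by (intro Bochner_Integration.integral_cong) (auto simp: field_simps)
  also have "\<dots> = axis_moment / (2 * pi)" by (simp only: axis_moment_def integral_divide_zero)
  finally show ?thesis .
qed

lemma snd_u_0: "snd (u 0) = 0"
  using snd_u_reflect[of 0 0] by (simp add: zero_prod_def)

text \<open>Integrating over the second point yields f (u^1 x_2 + u^2 x_1) / |x|^2. Keeping both
  points visible allows their roles to be exchanged.\<close>

definition interaction :: "real \<times> real \<Rightarrow> real \<times> real \<Rightarrow> real" where
  "interaction x y = f x * f y * (biot_savart (x - y) \<bullet> (snd x, fst x)) / (norm x)\<^sup>2"

lemma abs_interaction_le: "\<bar>interaction x y\<bar> \<le> \<bar>f x\<bar> / norm x * (\<bar>f y\<bar> * inverse (norm (x - y)))"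
proof (cases "x = 0")
  case False
  have n: "norm (snd x, fst x) = norm x" by (cases x) (simp add: norm_Pair add.commute)
  have "\<bar>biot_savart (x - y) \<bullet> (snd x, fst x)\<bar> \<le> norm (biot_savart (x - y)) * norm x"
    using Cauchy_Schwarz_ineq2[of "biot_savart (x - y)" "(snd x, fst x)"] n by simp
  also have "\<dots> \<le> inverse (norm (x - y)) * norm x"
    by (intro mult_right_mono norm_biot_savart_le) auto
  finally have "\<bar>f x\<bar> * \<bar>f y\<bar> * \<bar>biot_savart (x - y) \<bullet> (snd x, fst x)\<bar> / (norm x)\<^sup>2
      \<le> \<bar>f x\<bar> * \<bar>f y\<bar> * (inverse (norm (x - y)) * norm x) / (norm x)\<^sup>2"
    by (intro divide_right_mono mult_left_mono) auto
  also have "\<dots> = \<bar>f x\<bar> / norm x * (\<bar>f y\<bar> * inverse (norm (x - y)))"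
    using False by (simp add: power2_eq_square)
  finally show ?thesis by (simp add: interaction_def abs_mult)
qed (simp add: interaction_def)

text \<open>The bound of \<open>abs_interaction_le\<close> splits: the inner integral is at most
  \<open>potential_bound\<close> when x lies in the support of \<open>f\<close>, and |f(x)| / |x|
  remains outside, which is integrable. Joint integrability is what permits swapping the order of
  integration.\<close>

lemma integrable_interaction: "integrable (lborel \<Otimes>\<^sub>M lborel) (\<lambda>(x, y). interaction x y)"
proof (rule lborel_pair.Fubini_integrable)
  have fb: "f \<in> borel_measurable (borel \<Otimes>\<^sub>M borel)"
    using f_borel by (simp only: borel_prod)
  show meas: "(\<lambda>(x, y). interaction x y) \<in> borel_measurable (lborel \<Otimes>\<^sub>M lborel)"
    unfolding interaction_def inner_prod_def by measurable
  have int: "integrable lborel (\<lambda>y. \<bar>f x\<bar> / norm x * (\<bar>f y\<bar> * inverse (norm (x - y))))" for x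
    using integrable_f_inverse_norm by auto
  have Fy: "integrable lborel (interaction x)" for x
  proof (rule Bochner_Integration.integrable_bound[OF int[of x]])
    show "interaction x \<in> borel_measurable lborel"
      unfolding interaction_def[abs_def] inner_prod_def by measurable
  qed (use abs_interaction_le[of x] in \<open>auto simp: abs_mult\<close>)
  then show "AE x in lborel. integrable lborel (\<lambda>y. case (x, y) of (x, y) \<Rightarrow> interaction x y)" by simp
  show "integrable lborel (\<lambda>x. LINT y|lborel. norm (case (x, y) of (x, y) \<Rightarrow> interaction x y))"
  proof (rule Bochner_Integration.integrable_bound[OF integrable_mult_right[OF integrable_f_div_norm, of potential_bound]])
    have "(\<lambda>x. LINT y|lborel. norm (interaction x y)) \<in> borel_measurable lborel"
      by (rule lborel.borel_measurable_lebesgue_integral) (use meas in measurable)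
    then show "(\<lambda>x. LINT y|lborel. norm (case (x, y) of (x, y) \<Rightarrow> interaction x y)) \<in> borel_measurable lborel"
      by simp
    have "(LINT y|lborel. \<bar>interaction x y\<bar>) \<le> potential_bound * (\<bar>f x\<bar> / norm x)" for x
    proof (cases "f x = 0")
      case False
      have "(LINT y|lborel. \<bar>interaction x y\<bar>) \<le> (LINT y|lborel. \<bar>f x\<bar> / norm x * (\<bar>f y\<bar> * inverse (norm (x - y))))"
        by (intro integral_mono int abs_interaction_le integrable_abs Fy)
      also have "\<dots> = \<bar>f x\<bar> / norm x * (LINT y|lborel. \<bar>f y\<bar> * inverse (norm (x - y)))"
        by simp
      also have "\<dots> \<le> \<bar>f x\<bar> / norm x * potential_bound"
        by (intro mult_left_mono integral_f_inverse_norm_le f_supp False) auto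
      finally show ?thesis by (simp add: mult.commute)
    qed (simp add: interaction_def)
    moreover have "potential_bound * (\<bar>f x\<bar> / norm x) \<le> \<bar>potential_bound\<bar> * (\<bar>f x\<bar> / norm x)" for x
      by (intro mult_right_mono) auto
    ultimately have "(LINT y|lborel. \<bar>interaction x y\<bar>) \<le> \<bar>potential_bound\<bar> * (\<bar>f x\<bar> / norm x)" for x
      by (rule order_trans)
    then have "norm (LINT y|lborel. norm (case (x, y) of (x, y) \<Rightarrow> interaction x y))
        \<le> norm (potential_bound * (f x / norm x))" for x
      unfolding real_norm_def abs_mult abs_divide abs_norm_cancel by simp
    then show "AE x in lborel. norm (LINT y|lborel. norm (case (x, y) of (x, y) \<Rightarrow> interaction x y))
        \<le> norm (potential_bound * (f x / norm x))"
      by (rule AE_I2)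
  qed
qed

text \<open>In complex notation \<^term>\<open>interaction\<close> is \<open>f(z) f(w) Re (1 / ((z - w) z)) / 2\<pi>\<close>, and
  \<open>1 / ((z - w) z) + 1 / ((w - z) w) = - 1 / (z w)\<close>.\<close>

lemma interaction_symmetrized:
  assumes "x \<noteq> 0" "y \<noteq> 0" "x \<noteq> y"
  shows "interaction x y + interaction y x = (f x * snd x / (norm x)\<^sup>2 * (f y * snd y / (norm y)\<^sup>2)
      - f x * fst x / (norm x)\<^sup>2 * (f y * fst y / (norm y)\<^sup>2)) / (2 * pi)"
proof -
  obtain a b c d where xy: "x = (a, b)" "y = (c, d)" by (cases x; cases y)
  have n: "(norm x)\<^sup>2 = a\<^sup>2 + b\<^sup>2" "(norm y)\<^sup>2 = c\<^sup>2 + d\<^sup>2"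
    "(norm (x - y))\<^sup>2 = (a - c)\<^sup>2 + (b - d)\<^sup>2" "(norm (y - x))\<^sup>2 = (a - c)\<^sup>2 + (b - d)\<^sup>2"
    by (simp_all add: xy norm_Pair power2_commute)
  have nz: "a\<^sup>2 + b\<^sup>2 \<noteq> 0" "c\<^sup>2 + d\<^sup>2 \<noteq> 0" "(a - c)\<^sup>2 + (b - d)\<^sup>2 \<noteq> 0"
    using assms by (auto simp: xy zero_prod_def sum_power2_eq_zero_iff)
  \<comment> \<open>The denominators are kept opaque so that clearing them reduces the claim to a
    single polynomial identity with the factor X = |x - y|^2, which cancels the singularity.\<close>
  have id: "((a - c) * a - (b - d) * b) / (X * P) + ((c - a) * c - (d - b) * d) / (X * Q)
      = (b / P) * (d / Q) - (a / P) * (c / Q)"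
    if "X = (a - c)\<^sup>2 + (b - d)\<^sup>2" "P = a\<^sup>2 + b\<^sup>2" "Q = c\<^sup>2 + d\<^sup>2" "X \<noteq> 0" "P \<noteq> 0" "Q \<noteq> 0" for X P Q
  proof -
    have "((a - c) * a - (b - d) * b) * Q + ((c - a) * c - (d - b) * d) * P = (b * d - a * c) * X"
      unfolding that(1-3) by (simp add: power2_eq_square algebra_simps)
    then show ?thesis using that(4-6) by (simp add: divide_simps)
  qed
  have "interaction x y + interaction y x = f x * f y / (2 * pi) *
      (((a - c) * a - (b - d) * b) / (((a - c)\<^sup>2 + (b - d)\<^sup>2) * (a\<^sup>2 + b\<^sup>2))
      + ((c - a) * c - (d - b) * d) / (((a - c)\<^sup>2 + (b - d)\<^sup>2) * (c\<^sup>2 + d\<^sup>2)))"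
    unfolding interaction_def inner_biot_savart n by (simp add: xy algebra_simps add_divide_distrib)
  also note id[OF refl refl refl nz(3,1,2)]
  finally show ?thesis unfolding n by (simp add: xy algebra_simps diff_divide_distrib)
qed

lemma integral_interaction: "(LINT y|lborel. interaction x y) = f x * (u x \<bullet> (snd x, fst x)) / (norm x)\<^sup>2"
proof -
  have "(LINT y|lborel. interaction x y)
      = (LINT y|lborel. f x / (norm x)\<^sup>2 * (f y * (biot_savart (x - y) \<bullet> (snd x, fst x))))"
    by (intro Bochner_Integration.integral_cong) (auto simp: interaction_def)
  then show ?thesis by (simp add: inner_u)
qed

text \<open>The symmetrized kernel is a sum of products of a function of x and a function of y, so
  its double integral factors. Only the product of second coordinates survives and gives
  B^2/(2\<pi>), which is twice the integral sought.\<close>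

lemma symmetrized_identity:
  "integrable lborel (\<lambda>x. f x * (u x \<bullet> (snd x, fst x)) / (norm x)\<^sup>2)" (is ?int)
  "(LINT x|lborel. f x * (u x \<bullet> (snd x, fst x)) / (norm x)\<^sup>2) = axis_moment\<^sup>2 / (4 * pi)" (is ?eq)
proof -
  note fst = lborel_pair.integrable_fst[OF integrable_interaction] lborel_pair.AE_integrable_fst[OF integrable_interaction]
    lborel_pair.integral_fst[OF integrable_interaction]
  note snd = lborel_pair.integrable_snd[OF integrable_interaction] lborel_pair.AE_integrable_snd[OF integrable_interaction]
    lborel_pair.integral_snd[OF integrable_interaction]
  show ?int using fst(1) by (simp add: integral_interaction)
  let ?I = "LINT x|lborel. LINT y|lborel. interaction x y"
  \<comment> \<open>Both iterated integrals equal the integral over the product, so exchanging the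
    two points changes nothing.\<close>
  have "2 * ?I = ?I + (LINT x|lborel. LINT y|lborel. interaction y x)"
    using fst(3) snd(3) by simp
  also have "\<dots> = (LINT x|lborel. (LINT y|lborel. interaction x y) + (LINT y|lborel. interaction y x))"
    using fst(1) snd(1) by simp
  also have "\<dots> = (LINT x|lborel. f x * snd x / (norm x)\<^sup>2 * (axis_moment / (2 * pi)))"
  proof (rule Bochner_Integration.integral_cong_AE)
    show "(\<lambda>x. (LINT y|lborel. interaction x y) + (LINT y|lborel. interaction y x)) \<in> borel_measurable lborel"
      using fst(1) snd(1) by (intro borel_measurable_add) (auto dest: borel_measurable_integrable)
    show "(\<lambda>x. f x * snd x / (norm x)\<^sup>2 * (axis_moment / (2 * pi))) \<in> borel_measurable lborel"
      by measurable
    show "AE x in lborel. (LINT y|lborel. interaction x y) + (LINT y|lborel. interaction y x)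
        = f x * snd x / (norm x)\<^sup>2 * (axis_moment / (2 * pi))"
      using fst(2) snd(2) AE_lborel_singleton[of "0::real\<times>real"]
    proof eventually_elim
      case (elim x)
      have "(LINT y|lborel. interaction x y) + (LINT y|lborel. interaction y x) = (LINT y|lborel. interaction x y + interaction y x)"
        using elim by simp
      also have "\<dots> = (LINT y|lborel. (f x * snd x / (norm x)\<^sup>2 * (f y * snd y / (norm y)\<^sup>2)
          - f x * fst x / (norm x)\<^sup>2 * (f y * fst y / (norm y)\<^sup>2)) / (2 * pi))"
      proof (rule Bochner_Integration.integral_cong_AE)
        show "AE y in lborel. interaction x y + interaction y x = (f x * snd x / (norm x)\<^sup>2 * (f y * snd y / (norm y)\<^sup>2)
          - f x * fst x / (norm x)\<^sup>2 * (f y * fst y / (norm y)\<^sup>2)) / (2 * pi)"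
          using AE_lborel_singleton[of "0::real\<times>real"] AE_lborel_singleton[of x]
          by eventually_elim (rule interaction_symmetrized; use elim in auto)
        show "(\<lambda>y. interaction x y + interaction y x) \<in> borel_measurable lborel"
          using elim by (intro borel_measurable_add) (auto dest: borel_measurable_integrable)
      qed measurable
      also have "\<dots> = (f x * snd x / (norm x)\<^sup>2 * axis_moment
          - f x * fst x / (norm x)\<^sup>2 * (LINT y|lborel. f y * fst y / (norm y)\<^sup>2)) / (2 * pi)"
        unfolding integral_divide_zero axis_moment_def
        by (subst Bochner_Integration.integral_diff)
           (intro integrable_mult_right integrable_f_coord | simp only: integral_mult_right_zero)+
      finally show ?case by (simp add: integral_f_fst_eq_0)
    qed
  qed
  also have "\<dots> = axis_moment * (axis_moment / (2 * pi))"
    by (simp only: integral_mult_left_zero axis_moment_def)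
  finally have "2 * ?I = axis_moment * (axis_moment / (2 * pi))" .
  then show ?eq by (simp add: integral_interaction power2_eq_square field_simps)
qed

end

section \<open>Travelling test functions\<close>

text \<open>A cutoff in time with support in [1, 2], an interval bounded away from the initial time
  as the test functions require.\<close>

definition bump :: "real \<Rightarrow> real" where
  "bump t = flat 0 (t - 1) * flat 0 (2 - t)"

definition bump' :: "real \<Rightarrow> real" where
  "bump' t = flat 2 (t - 1) * flat 0 (2 - t) - flat 0 (t - 1) * flat 2 (2 - t)"

lemma flat_eq_0: "t \<le> 0 \<Longrightarrow> flat k t = 0"
  by (simp add: flat_def)

lemma DERIV_flat_0: "(flat 0 has_real_derivative flat 2 t) (at t)"
  using DERIV_flat[of 0 t] by (simp add: numeral_2_eq_2)

lemma continuous_on_flat: "continuous_on A (flat k)"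
  by (rule DERIV_continuous_on[OF has_field_derivative_at_within[OF DERIV_flat]])

lemma DERIV_bump: "(bump has_real_derivative bump' t) (at t)"
proof -
  have "((\<lambda>t. flat 0 (t - 1)) has_real_derivative flat 2 (t - 1) * 1) (at t)"
    by (rule DERIV_chain2[OF DERIV_flat_0]) (auto intro!: derivative_eq_intros)
  moreover have "((\<lambda>t. flat 0 (2 - t)) has_real_derivative flat 2 (2 - t) * (-1)) (at t)"
    by (rule DERIV_chain2[OF DERIV_flat_0]) (auto intro!: derivative_eq_intros)
  ultimately show ?thesis
    unfolding bump_def[abs_def] bump'_def by (auto dest: DERIV_mult simp: algebra_simps)
qed

lemma bump_eq_0: "t \<notin> {1..2} \<Longrightarrow> bump t = 0" and bump'_eq_0: "t \<notin> {1..2} \<Longrightarrow> bump' t = 0"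
  by (auto simp: bump_def bump'_def flat_eq_0)

lemma continuous_on_bump: "continuous_on A bump" and continuous_on_bump': "continuous_on A bump'"
  unfolding bump_def[abs_def] bump'_def[abs_def]
  by (auto intro!: continuous_intros continuous_on_compose2[OF continuous_on_flat[of UNIV]])

lemma indicator_bump: "indicator {1..2} t *\<^sub>R bump t = bump t"
  and indicator_bump': "indicator {1..2} t *\<^sub>R bump' t = bump' t"
  using bump_eq_0 bump'_eq_0 by (auto simp: indicator_def)

lemma integrable_bump: "integrable lborel bump" and integrable_bump': "integrable lborel bump'"
  using borel_integrable_atLeastAtMost'[OF continuous_on_bump, of 1 2]
    borel_integrable_atLeastAtMost'[OF continuous_on_bump', of 1 2]
  unfolding set_integrable_def indicator_bump indicator_bump' by auto

lemma integral_bump': "(LINT t|lborel. bump' t) = 0"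
proof -
  have "(LINT t|lborel. indicator {1..2} t *\<^sub>R bump' t) = bump 2 - bump 1"
    by (rule integral_FTC_atLeastAtMost)
       (auto intro: continuous_on_bump' has_vector_derivative_at_within
          DERIV_bump[unfolded has_real_derivative_iff_has_vector_derivative])
  then show ?thesis unfolding indicator_bump' by (simp add: bump_def flat_eq_0)
qed

lemma integral_bump_pos: "(LINT t|lborel. bump t) > 0"
proof (rule integral_pos_if_open[OF integrable_bump, where V = "{1<..<2}"])
  show "{1<..<2::real} \<noteq> {}" by (simp add: not_le)
qed (auto simp: bump_def flat_def)

lemma smooth_bump_fst: "smooth (\<lambda>z::real \<times> real \<times> real. bump (fst z))"
proof -
  have "smooth (\<lambda>z::real \<times> real \<times> real. fst z + (-1))"
    by (intro smooth_add smooth_const smooth_linear bounded_linear_fst)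
  moreover have "smooth (\<lambda>z::real \<times> real \<times> real. (-1) * fst z + 2)"
    by (intro smooth_add smooth_mult smooth_const smooth_linear bounded_linear_fst)
  ultimately have "smooth (\<lambda>z::real \<times> real \<times> real. flat 0 (fst z + (-1)) * flat 0 ((-1) * fst z + 2))"
    by (intro smooth_mult smooth_compose[OF smooth_flat])
  then show ?thesis by (simp add: bump_def)
qed

context odd_vorticity begin

lemma velocity_translate:
  assumes "\<And>x. \<theta> t x = f (x - c)"
  shows "velocity \<theta> t x = u (x - c)"
proof -
  have "velocity \<theta> t x = (LINT y|lborel. f (y - c) *\<^sub>R biot_savart (x - y))"
    by (simp add: velocity_def convolution_def assms)
  also have "\<dots> = (LINT y|lborel. f ((fst c + fst y, snd c + snd y) - c) *\<^sub>R
      biot_savart (x - (fst c + fst y, snd c + snd y)))"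
    using integral_plane_rigid[of "(1,1)" "\<lambda>y. f (y - c) *\<^sub>R biot_savart (x - y)" c]
    by (simp only: fst_conv snd_conv mult_1 abs_one) measurable
  also have "\<dots> = u (x - c)"
  proof -
    have e: "(fst c + fst y, snd c + snd y) - c = y" "x - (fst c + fst y, snd c + snd y) = x - c - y" for y
      by (simp_all add: prod_eq_iff)
    show ?thesis unfolding e u_def convolution_def ..
  qed
  finally show ?thesis .
qed

text \<open>The test function is bump(t) \<psi>(x_1 - W t, x_2). In the moving frame its time
  derivative contributes -W times the first partial of \<psi>, whence u - (W, 0). The remaining term
  carries \<open>bump'\<close>, whose integral is 0, while \<open>bump\<close> has positive
  integral, so the steady integral must vanish. Smoothness is assumed of the travelling profile on
  space-time, the form in which the test function uses it.\<close>

lemma steady_weak_form: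
  assumes W: "W > 0"
    and sol: "solves_euler_vorticity \<theta>\<^sub>0 \<theta>"
    and \<theta>: "\<And>t x. t \<ge> 0 \<Longrightarrow> \<theta> t x = f (x - t *\<^sub>R (W, 0))"
    and sm: "smooth (\<lambda>z::real\<times>real\<times>real. \<psi> (fst (snd z) - W * fst z, snd (snd z)))"
    and der: "\<And>p. (\<psi> has_derivative (\<lambda>h. fst h * P1 p + snd h * P2 p)) (at p)"
    and bd: "\<And>p. \<psi> p \<noteq> 0 \<Longrightarrow> p \<in> box_of S"
    and int1: "integrable lborel (\<lambda>p. f p * \<psi> p)"
    and int2: "integrable lborel (\<lambda>p. f p * ((u p - (W, 0)) \<bullet> (P1 p, P2 p)))"
  shows "(LINT p|lborel. f p * ((u p - (W, 0)) \<bullet> (P1 p, P2 p))) = 0"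
proof -
  define g1 where "g1 = (\<lambda>p. f p * \<psi> p)"
  define g2 where "g2 = (\<lambda>p. f p * ((u p - (W, 0)) \<bullet> (P1 p, P2 p)))"
  define mv where "mv = (\<lambda>z::real\<times>real\<times>real. (fst (snd z) - W * fst z, snd (snd z)))"
  define \<phi> where "\<phi> = (\<lambda>z. bump (fst z) * \<psi> (mv z))"
  have mv: "mv (t, x) = x - t *\<^sub>R (W, 0)" for t x by (simp add: mv_def prod_eq_iff)
  let ?F = "\<lambda>z. \<theta> (fst z) (snd z) * (dt \<phi> z + velocity \<theta> (fst z) (snd z) \<bullet> grad \<phi> z)"
  have "test_function space_time \<phi>"
  proof -
    \<comment> \<open>The profile moves by W t \<le> 2 W while \<open>bump\<close> is active, which
      fixes the horizontal margin.\<close>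
    define K where "K = {1..2::real} \<times> {-(S + 2 * W)..S + 2 * W} \<times> {-S..S}"
    have "z \<in> K" if "\<phi> z \<noteq> 0" for z
    proof -
      have t: "fst z \<in> {1..2}" and "mv z \<in> box_of S"
        using that bump_eq_0[of "fst z"] bd[of "mv z"] by (auto simp: \<phi>_def)
      moreover have "0 \<le> W * fst z" "W * fst z \<le> 2 * W" using t W by auto
      ultimately show ?thesis by (cases z) (auto simp: K_def mv_def mem_box_of)
    qed
    moreover have K: "compact K" unfolding K_def by (intro compact_Times compact_Icc)
    ultimately have sub: "supp \<phi> \<subseteq> K"
      unfolding supp_def by (intro closure_minimal) (auto dest: compact_imp_closed)
    then have "compact (supp \<phi>)"
      using K compact_Int_closed[of K "supp \<phi>"] by (simp add: supp_def Int_absorb1)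
    moreover have "K \<subseteq> space_time" by (auto simp: K_def space_time_def)
    moreover have "smooth \<phi>"
      unfolding \<phi>_def mv_def by (intro smooth_mult smooth_bump_fst sm)
    ultimately show ?thesis using sub by (auto simp: test_function_def)
  qed
  then have set_int: "set_integrable lborel space_time ?F"
    and set_0: "(LINT z:space_time|lborel. ?F z) = 0"
    using sol by (auto simp: solves_euler_vorticity_def Let_def)
  have d\<phi>: "(\<phi> has_derivative (\<lambda>h. bump (fst z) * ((fst (snd h) - W * fst h) * P1 (mv z)
      + snd (snd h) * P2 (mv z)) + fst h * bump' (fst z) * \<psi> (mv z))) (at z)" for z
  proof -
    have b: "((\<lambda>z. bump (fst z)) has_derivative (\<lambda>h. fst h * bump' (fst z))) (at z)"
      using has_derivative_compose[OF has_derivative_fst[OF has_derivative_ident]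
          DERIV_bump[unfolded has_field_derivative_def], of z UNIV]
      by (simp add: mult.commute)
    have "(mv has_derivative (\<lambda>h. (fst (snd h) - W * fst h, snd (snd h)))) (at z)"
      unfolding mv_def by (auto intro!: derivative_eq_intros)
    from has_derivative_compose[OF this der]
    have "((\<lambda>z. \<psi> (mv z)) has_derivative
        (\<lambda>h. (fst (snd h) - W * fst h) * P1 (mv z) + snd (snd h) * P2 (mv z))) (at z)"
      by simp
    from has_derivative_mult[OF b this] show ?thesis unfolding \<phi>_def by simp
  qed
  have fd: "frechet_derivative \<phi> (at z) = (\<lambda>h. bump (fst z) * ((fst (snd h) - W * fst h) * P1 (mv z)
      + snd (snd h) * P2 (mv z)) + fst h * bump' (fst z) * \<psi> (mv z))" for z
    using frechet_derivative_at[OF d\<phi>[of z]] by simp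
  \<comment> \<open>For t \<le> 0 both sides are 0, since \<open>bump\<close> and
    \<open>bump'\<close> vanish outside [1, 2].\<close>
  have F: "indicator space_time (t, x) *\<^sub>R ?F (t, x)
      = bump' t * g1 (x - t *\<^sub>R (W, 0)) + bump t * g2 (x - t *\<^sub>R (W, 0))" for t x
  proof (cases "t > 0")
    case True
    then have "velocity \<theta> t x = u (mv (t, x))"
      using \<theta>[of t] by (simp add: mv velocity_translate)
    then show ?thesis
      using True by (simp add: \<theta> space_time_def dt_def grad_def fd g1_def g2_def mv
          inner_prod_def algebra_simps)
  next
    case False
    then show ?thesis using bump_eq_0[of t] bump'_eq_0[of t] by (simp add: space_time_def)
  qed
  have shift: "integrable lborel (\<lambda>x. g (x - c))" "(LINT x|lborel. g (x - c)) = (LINT x|lborel. g x)"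
    if "integrable lborel g" for g :: "real \<times> real \<Rightarrow> real" and c
  proof -
    have "(fst (- c) + fst (1,1) * fst x, snd (- c) + snd (1,1) * snd x) = x - c" for x
      by (simp add: prod_eq_iff)
    then show "integrable lborel (\<lambda>x. g (x - c))" "(LINT x|lborel. g (x - c)) = (LINT x|lborel. g x)"
      using that integral_plane_rigid[of "(1,1)" g "- c"] integrable_plane_rigid[of "(1,1)" g "- c"]
      by (auto dest: borel_measurable_integrable)
  qed
  have i: "integrable lborel g1" "integrable lborel g2" using int1 int2 by (simp_all add: g1_def g2_def)
  have "integrable (lborel \<Otimes>\<^sub>M lborel) (\<lambda>z. indicator space_time z *\<^sub>R ?F z)"
    using set_int by (simp add: set_integrable_def lborel_prod)
  from lborel_pair.integral_fst'[OF this]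
  have "0 = (LINT t|lborel. LINT x|lborel. indicator space_time (t, x) *\<^sub>R ?F (t, x))"
    using set_0 by (simp add: set_lebesgue_integral_def lborel_prod)
  also have "\<dots> = (LINT t|lborel. bump' t * (LINT x|lborel. g1 x) + bump t * (LINT x|lborel. g2 x))"
    unfolding F using i by (simp add: shift)
  also have "\<dots> = (LINT t|lborel. bump t) * (LINT x|lborel. g2 x)"
    using integrable_bump integrable_bump' by (simp add: integral_bump')
  finally show ?thesis using integral_bump_pos by (simp add: g2_def)
qed

end

section \<open>Testing with the angle function\<close>

text \<open>Composing \<^term>\<open>flat 0\<close> with itself gives a plateau without any division: the outer argument is
  \<open>1\<close> on the disc \<open>|p|\<^sup>2 \<le> M\<close>, and nonpositive once \<open>flat 0 (|p|\<^sup>2 - M) \<ge> exp (-1)\<close>.\<close>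

definition cutoff :: "real \<Rightarrow> real \<times> real \<Rightarrow> real" where
  "cutoff M p = exp 1 * flat 0 (1 + - exp 1 * flat 0 (fst p * fst p + snd p * snd p + - M))"

definition cutoff' :: "real \<Rightarrow> real \<times> real \<Rightarrow> real" where
  "cutoff' M p = exp 1 * (flat 2 (1 + - exp 1 * flat 0 (fst p * fst p + snd p * snd p + - M))
    * (- exp 1 * flat 2 (fst p * fst p + snd p * snd p + - M)))"

lemma has_derivative_flat_compose:
  assumes "(g has_derivative g') (at p)"
  shows "((\<lambda>p. flat 0 (g p)) has_derivative (\<lambda>h. flat 2 (g p) * g' h)) (at p)"
  using has_derivative_compose[OF assms DERIV_flat_0[unfolded has_field_derivative_def]] .

lemma has_derivative_cutoff:
  "(cutoff M has_derivative (\<lambda>h. cutoff' M p * (2 * fst p * fst h + 2 * snd p * snd h))) (at p)"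
proof -
  have "((\<lambda>p. fst p * fst p + snd p * snd p + - M) has_derivative
      (\<lambda>h. 2 * fst p * fst h + 2 * snd p * snd h)) (at p)" for p :: "real \<times> real"
    by (auto intro!: derivative_eq_intros)
  note a = has_derivative_flat_compose[OF this]
  have "((\<lambda>p. 1 + - exp 1 * flat 0 (fst p * fst p + snd p * snd p + - M)) has_derivative
      (\<lambda>h. - exp 1 * (flat 2 (fst p * fst p + snd p * snd p + - M) * (2 * fst p * fst h + 2 * snd p * snd h))))
      (at p)"
    by (rule has_derivative_eq_rhs[OF has_derivative_add[OF has_derivative_const has_derivative_mult_right[OF a]]])
       simp
  from has_derivative_mult_right[OF has_derivative_flat_compose[OF this], of "exp 1"]
  show ?thesis unfolding cutoff_def[abs_def] cutoff'_def by (simp add: mult_ac)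
qed

lemma cutoff_eq_1: "fst p * fst p + snd p * snd p \<le> M \<Longrightarrow> cutoff M p = 1"
  and cutoff'_eq_0: "fst p * fst p + snd p * snd p \<le> M \<Longrightarrow> cutoff' M p = 0"
  by (simp_all add: cutoff_def cutoff'_def flat_eq_0) (simp add: flat_def exp_minus)

lemma cutoff_eq_0:
  assumes "fst p * fst p + snd p * snd p \<ge> M + 1"
  shows "cutoff M p = 0"
proof -
  let ?s = "fst p * fst p + snd p * snd p + - M"
  have "?s \<ge> 1" using assms by simp
  then have "inverse ?s \<le> 1" by (intro inverse_le_1_iff[THEN iffD2]) auto
  then have "exp (- 1) \<le> flat 0 ?s" using \<open>?s \<ge> 1\<close> by (simp add: flat_def)
  then have "exp 1 * exp (- 1) \<le> exp 1 * flat 0 ?s" by (intro mult_left_mono) auto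
  then have "1 + - exp 1 * flat 0 ?s \<le> 0" by (simp add: exp_minus)
  then show ?thesis unfolding cutoff_def by (simp only: flat_eq_0 mult_zero_right)
qed

text \<open>A smooth odd approximation of \<open>sgn (x\<^sub>2) arctan (x\<^sub>1 / \<bar>x\<^sub>2\<bar>)\<close>, cut off at infinity.\<close>

definition rinv :: "real \<Rightarrow> real \<Rightarrow> real" where
  "rinv e y = (e + y\<^sup>2) powr (- 1 / 2)"

definition angle :: "real \<Rightarrow> real \<Rightarrow> real \<times> real \<Rightarrow> real" where
  "angle e M p = arctan (fst p * rinv e (snd p)) * (snd p * rinv e (snd p)) * cutoff M p"

definition angle1 :: "real \<Rightarrow> real \<times> real \<Rightarrow> real" where
  "angle1 e p = snd p / (e + (snd p)\<^sup>2 + (fst p)\<^sup>2)"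

text \<open>The first term is the smeared jump: e (e + y^2)^(-3/2) is the derivative of the smoothed
  sign y (e + y^2)^(-1/2). It tends to 0 at each point off the axis while its integral in y stays 2,
  so convergence needs help from u^2. The second term is the regular part.\<close>

definition angle2 :: "real \<Rightarrow> real \<times> real \<Rightarrow> real" where
  "angle2 e p = arctan (fst p * rinv e (snd p)) * (e * (e + (snd p)\<^sup>2) powr (- 3 / 2))
     - fst p * (snd p)\<^sup>2 / ((e + (snd p)\<^sup>2) * (e + (snd p)\<^sup>2 + (fst p)\<^sup>2))"

lemma smooth_angle:
  assumes e: "e > 0"
  shows "smooth (\<lambda>z::real\<times>real\<times>real. angle e M (fst (snd z) - W * fst z, snd (snd z)))"
proof -
  have L1: "smooth (\<lambda>z::real\<times>real\<times>real. fst (snd z) - W * fst z)"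
    by (intro smooth_linear bounded_linear_sub bounded_linear_const_mult
        bounded_linear_fst bounded_linear_compose[OF bounded_linear_fst bounded_linear_snd])
  have L2: "smooth (\<lambda>z::real\<times>real\<times>real. snd (snd z))"
    by (intro smooth_linear bounded_linear_compose[OF bounded_linear_snd bounded_linear_snd])
  have r: "smooth (rinv e)"
    unfolding rinv_def[abs_def] by (rule smooth_powr_shifted_square[OF e])
  show ?thesis
    \<comment> \<open>Only sums, products, constants and compositions with functions of one variable
      remain. For this reason \<open>cutoff\<close> is written with products and negated summands
      instead of squares and differences.\<close>
    unfolding angle_def cutoff_def fst_conv snd_conv
    by (intro smooth_mult smooth_add smooth_const L1 L2 smooth_compose[OF smooth_arctan]
        smooth_compose[OF smooth_flat] smooth_compose[OF r])
qed

lemma rinv_powers: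
  assumes "e > 0"
  shows "rinv e y > 0" "(rinv e y)\<^sup>2 = 1 / (e + y\<^sup>2)" "(rinv e y) ^ 3 = (e + y\<^sup>2) powr (- 3 / 2)"
proof -
  have pos: "e + y\<^sup>2 > 0" using assms by (simp add: add_pos_nonneg)
  then show r: "rinv e y > 0" by (simp add: rinv_def)
  have n: "(rinv e y) ^ n = (e + y\<^sup>2) powr (- 1 / 2 * real n)" for n
    unfolding powr_realpow[OF r, symmetric] unfolding rinv_def powr_powr ..
  show "(rinv e y)\<^sup>2 = 1 / (e + y\<^sup>2)"
    unfolding n using pos by (simp add: powr_minus_divide)
  show "(rinv e y) ^ 3 = (e + y\<^sup>2) powr (- 3 / 2)"
    unfolding n by simp
qed

text \<open>Partial derivatives exist everywhere, but explicit formulas are wanted only where the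
  cutoff is constant, because \<open>f\<close> will be supported inside that disc.\<close>

lemma has_derivative_angle:
  assumes e: "e > 0"
  obtains P1 P2 where
    "\<And>p. (angle e M has_derivative (\<lambda>h. fst h * P1 p + snd h * P2 p)) (at p)"
    "\<And>p. fst p * fst p + snd p * snd p \<le> M \<Longrightarrow> P1 p = angle1 e p"
    "\<And>p. fst p * fst p + snd p * snd p \<le> M \<Longrightarrow> P2 p = angle2 e p"
proof -
  define a b where "a = (\<lambda>p. arctan (fst p * rinv e (snd p)))" and "b = (\<lambda>p::real\<times>real. snd p * rinv e (snd p))"
  define A1 A2 B2 where "A1 = (\<lambda>p. rinv e (snd p) / (1 + (fst p * rinv e (snd p))\<^sup>2))"
    and "A2 = (\<lambda>p. fst p * - (snd p * rinv e (snd p) ^ 3) / (1 + (fst p * rinv e (snd p))\<^sup>2))"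
    and "B2 = (\<lambda>p::real\<times>real. e * rinv e (snd p) ^ 3)"
  have r': "(rinv e has_real_derivative - (y * rinv e y ^ 3)) (at y)" for y
    unfolding rinv_powers(3)[OF e]
    using DERIV_powr_shifted_square[OF e, of "- 1 / 2" y] by (simp add: rinv_def[abs_def])
  have r: "((\<lambda>p. rinv e (snd p)) has_derivative (\<lambda>h. - (snd p * rinv e (snd p) ^ 3) * snd h)) (at p)"
    for p :: "real \<times> real"
    using has_derivative_compose[OF has_derivative_snd[OF has_derivative_ident]
        r'[unfolded has_field_derivative_def], of p UNIV] by simp
  have "((\<lambda>p. fst p * rinv e (snd p)) has_derivative
      (\<lambda>h. fst p * (- (snd p * rinv e (snd p) ^ 3) * snd h) + fst h * rinv e (snd p))) (at p)" for p :: "real\<times>real"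
    by (rule has_derivative_mult[OF has_derivative_fst[OF has_derivative_ident] r])
  note da' = has_derivative_compose[OF this DERIV_arctan[unfolded has_field_derivative_def]]
  have da: "(a has_derivative (\<lambda>h. fst h * A1 p + snd h * A2 p)) (at p)" for p
    unfolding a_def A1_def A2_def
    by (rule has_derivative_eq_rhs[OF da']) (simp add: fun_eq_iff divide_inverse algebra_simps)
  \<comment> \<open>This is the derivative of the smoothed sign; it follows from (e + y^2) (rinv e
    y)^2 = 1.\<close>
  have B2: "rinv e y - y\<^sup>2 * rinv e y ^ 3 = e * rinv e y ^ 3" for y
  proof -
    have "e + y\<^sup>2 > 0" using e by (simp add: add_pos_nonneg)
    then have "(e + y\<^sup>2) * (rinv e y)\<^sup>2 = 1" using rinv_powers(2)[OF e, of y] by simp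
    then have "rinv e y = rinv e y * ((e + y\<^sup>2) * (rinv e y)\<^sup>2)" by simp
    also have "\<dots> = (e + y\<^sup>2) * rinv e y ^ 3" by (simp add: power2_eq_square power3_eq_cube)
    finally show ?thesis by (simp add: algebra_simps)
  qed
  have "(b has_derivative (\<lambda>h. snd p * (- (snd p * rinv e (snd p) ^ 3) * snd h) + snd h * rinv e (snd p))) (at p)" for p
    unfolding b_def by (rule has_derivative_mult[OF has_derivative_snd[OF has_derivative_ident] r])
  moreover have "snd p * (- (snd p * rinv e (snd p) ^ 3) * snd h) + snd h * rinv e (snd p) = snd h * B2 p"
    for p h :: "real \<times> real"
    unfolding B2_def B2[symmetric] by (simp add: power2_eq_square algebra_simps)
  ultimately have db: "(b has_derivative (\<lambda>h. snd h * B2 p)) (at p)" for p by simp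
  have ang: "angle e M = (\<lambda>p. a p * b p * cutoff M p)"
    by (simp add: fun_eq_iff angle_def a_def b_def)
  define P1 P2 where "P1 = (\<lambda>p. A1 p * b p * cutoff M p + a p * b p * cutoff' M p * 2 * fst p)"
    and "P2 = (\<lambda>p. (A2 p * b p + a p * B2 p) * cutoff M p + a p * b p * cutoff' M p * 2 * snd p)"
  show thesis
  proof (rule that[of P1 P2])
    show "(angle e M has_derivative (\<lambda>h. fst h * P1 p + snd h * P2 p)) (at p)" for p
      unfolding ang
      by (rule has_derivative_eq_rhs[OF has_derivative_mult[OF has_derivative_mult[OF da db] has_derivative_cutoff]])
         (auto simp: P1_def P2_def fun_eq_iff algebra_simps)
    fix p :: "real \<times> real"
    assume p: "fst p * fst p + snd p * snd p \<le> M"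
    obtain x y where xy: "p = (x, y)" by (cases p)
    define r where "r = e + y\<^sup>2"
    have pos: "r > 0" "r + x\<^sup>2 > 0" using e by (auto simp: r_def add_pos_nonneg)
    note rp = rinv_powers(2)[OF e, of y, folded r_def]
    have "1 + (x * rinv e y)\<^sup>2 = (r + x\<^sup>2) / r"
      using pos by (simp add: power_mult_distrib rp field_simps)
    note d = this
    have "A1 p * b p = y * (rinv e y)\<^sup>2 / ((r + x\<^sup>2) / r)"
      unfolding A1_def b_def xy fst_conv snd_conv d by (simp add: power2_eq_square)
    also have "\<dots> = y / (r + x\<^sup>2)" using pos by (simp add: rp field_simps)
    finally show "P1 p = angle1 e p"
      using cutoff_eq_1[OF p] cutoff'_eq_0[OF p] by (simp add: P1_def angle1_def xy r_def)
    have "A2 p * b p = - x * y\<^sup>2 * ((rinv e y)\<^sup>2)\<^sup>2 / ((r + x\<^sup>2) / r)"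
      unfolding A2_def b_def xy fst_conv snd_conv d by (simp add: power2_eq_square power3_eq_cube)
    also have "\<dots> = - (x * y\<^sup>2 / (r * (r + x\<^sup>2)))"
      unfolding rp using pos by (simp add: divide_simps power2_eq_square)
    finally show "P2 p = angle2 e p"
      using cutoff_eq_1[OF p] cutoff'_eq_0[OF p]
      by (simp add: P2_def angle2_def xy r_def a_def B2_def rinv_powers(3)[OF e])
  qed
qed

section \<open>The angle gradient as e tends to 0: pointwise limits and uniform bounds\<close>

lemma tendsto_angle1:
  assumes "snd p \<noteq> 0" "e \<longlonglongrightarrow> 0"
  shows "(\<lambda>n. angle1 (e n) p) \<longlonglongrightarrow> snd p / (norm p)\<^sup>2"
proof -
  have "(snd p)\<^sup>2 + (fst p)\<^sup>2 > 0" using assms(1) by (simp add: add_pos_nonneg)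
  then have "(\<lambda>n. angle1 (e n) p) \<longlonglongrightarrow> snd p / (0 + (snd p)\<^sup>2 + (fst p)\<^sup>2)"
    unfolding angle1_def by (intro tendsto_intros assms(2)) auto
  then show ?thesis by (cases p) (simp add: norm_Pair add.commute)
qed

lemma tendsto_angle2:
  assumes y: "snd p \<noteq> 0" and e: "e \<longlonglongrightarrow> 0"
  shows "(\<lambda>n. angle2 (e n) p) \<longlonglongrightarrow> - fst p / (norm p)\<^sup>2"
proof -
  have pos: "(snd p)\<^sup>2 > 0" "(snd p)\<^sup>2 + (fst p)\<^sup>2 > 0" using y by (auto simp: add_pos_nonneg)
  have "(\<lambda>n. angle2 (e n) p) \<longlonglongrightarrow>
      arctan (fst p * (0 + (snd p)\<^sup>2) powr (- 1 / 2)) * (0 * (0 + (snd p)\<^sup>2) powr (- 3 / 2))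
     - fst p * (snd p)\<^sup>2 / ((0 + (snd p)\<^sup>2) * (0 + (snd p)\<^sup>2 + (fst p)\<^sup>2))"
    unfolding angle2_def rinv_def
    by (intro tendsto_intros e) (use pos in auto)
  also have "arctan (fst p * (0 + (snd p)\<^sup>2) powr (- 1 / 2)) * (0 * (0 + (snd p)\<^sup>2) powr (- 3 / 2))
     - fst p * (snd p)\<^sup>2 / ((0 + (snd p)\<^sup>2) * (0 + (snd p)\<^sup>2 + (fst p)\<^sup>2)) = - fst p / (norm p)\<^sup>2"
    using y by (cases p) (simp add: norm_Pair add.commute)
  finally show ?thesis .
qed

lemma abs_angle1_le:
  assumes "e > 0" "snd p \<noteq> 0"
  shows "\<bar>angle1 e p\<bar> \<le> 1 / norm p"
proof -
  have "(norm p)\<^sup>2 \<le> e + (snd p)\<^sup>2 + (fst p)\<^sup>2" "(norm p)\<^sup>2 > 0"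
    using assms by (cases p, auto simp: norm_Pair zero_prod_def)+
  then have "\<bar>angle1 e p\<bar> \<le> \<bar>snd p\<bar> / (norm p)\<^sup>2"
    unfolding angle1_def abs_divide by (intro frac_le) auto
  also have "\<dots> \<le> 1 / norm p" by (rule coord_div_norm_sq_le)
  finally show ?thesis .
qed

text \<open>With r = e + x_2^2, the smeared jump is at most 2 e r^(-3/2) \<le> 2 r^(-1/2) \<le>
  2/|x_2|, uniformly in \<open>e\<close>; the 2 is a crude bound for |arctan|. The regular part
  obeys the same bound 1/|p| as its limit.\<close>

lemma abs_angle2_le:
  assumes e: "e > 0" and y: "snd p \<noteq> 0"
  shows "\<bar>angle2 e p\<bar> \<le> 1 / norm p + 2 / \<bar>snd p\<bar>"
proof -
  define r where "r = e + (snd p)\<^sup>2"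
  have r: "r > 0" "e \<le> r" "(snd p)\<^sup>2 \<le> r" using e by (auto simp: r_def add_pos_nonneg)
  have N: "(norm p)\<^sup>2 \<le> r + (fst p)\<^sup>2" "(norm p)\<^sup>2 > 0"
    using e y unfolding r_def by (cases p, auto simp: norm_Pair zero_prod_def)+
  have "\<bar>fst p * (snd p)\<^sup>2 / (r * (r + (fst p)\<^sup>2))\<bar> = ((snd p)\<^sup>2 / r) * (\<bar>fst p\<bar> / (r + (fst p)\<^sup>2))"
    using r by (simp add: abs_mult abs_divide)
  also have "\<dots> \<le> 1 * (\<bar>fst p\<bar> / (norm p)\<^sup>2)"
    using r N by (intro mult_mono frac_le) auto
  also have "\<dots> \<le> 1 / norm p" using coord_div_norm_sq_le(1)[of p] by simp
  finally have 1: "\<bar>fst p * (snd p)\<^sup>2 / (r * (r + (fst p)\<^sup>2))\<bar> \<le> 1 / norm p" .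
  have "e * r powr (- 3 / 2) \<le> r * r powr (- 3 / 2)"
    using r by (intro mult_right_mono) auto
  also have "\<dots> = r powr (- 1 / 2)"
    using r powr_add[of r 1 "- 3 / 2"] by simp
  also have "\<dots> \<le> ((snd p)\<^sup>2) powr (- 1 / 2)"
    using r y by (intro powr_mono2') auto
  also have "\<dots> = 1 / \<bar>snd p\<bar>"
    using powr_minus_divide[of "(snd p)\<^sup>2" "1 / 2"] by (simp add: powr_half_sqrt)
  finally have 2: "e * r powr (- 3 / 2) \<le> 1 / \<bar>snd p\<bar>" .
  have "\<bar>arctan s\<bar> \<le> 2" for s
    using arctan_bounded[of s] pi_less_4 by auto
  then have "\<bar>arctan (fst p * rinv e (snd p))\<bar> * (e * r powr (- 3 / 2)) \<le> 2 * (1 / \<bar>snd p\<bar>)"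
    using e by (intro mult_mono 2) auto
  then have "\<bar>arctan (fst p * rinv e (snd p)) * (e * r powr (- 3 / 2))\<bar> \<le> 2 / \<bar>snd p\<bar>"
    using e by (simp add: abs_mult)
  with 1 show ?thesis unfolding angle2_def r_def[symmetric] by linarith
qed

lemma arctan_borel [measurable]: "arctan \<in> borel_measurable borel"
  by (intro borel_measurable_continuous_onI continuous_intros)

lemma angle_borel [measurable]:
  "angle1 e \<in> borel_measurable borel" "angle2 e \<in> borel_measurable borel"
  unfolding angle1_def[abs_def] angle2_def[abs_def] rinv_def by measurable

context odd_vorticity begin

text \<open>This is the singularity left when the bound sqrt |x_2| for u^2 meets 2/|x_2| from
  \<open>abs_angle2_le\<close>.\<close>

lemma integrable_f_snd_powr: "integrable lborel (\<lambda>p. f p * \<bar>snd p\<bar> powr (- 1 / 2))"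
proof -
  have "integrable lborel (\<lambda>p. indicator {-R..R} (fst p) * (indicator {-R..R} (snd p) * \<bar>snd p\<bar> powr (- 1 / 2)))"
    by (intro integrable_lborel_prod_mult integrable_abs_powr_Icc integrable_real_indicator)
      (auto simp: emeasure_lborel_Icc_eq)
  then show ?thesis
  proof (rule Bochner_Integration.integrable_bound)
    have "\<bar>f p * \<bar>snd p\<bar> powr (- 1 / 2)\<bar> \<le>
        \<bar>indicator {-R..R} (fst p) * (indicator {-R..R} (snd p) * \<bar>snd p\<bar> powr (- 1 / 2))\<bar>" for p
    proof (cases "f p = 0")
      case False
      then have "fst p \<in> {-R..R}" "snd p \<in> {-R..R}" using f_supp[of p] by (auto simp: mem_box_of)
      moreover have "\<bar>f p\<bar> * \<bar>snd p\<bar> powr (- 1 / 2) \<le> 1 * \<bar>snd p\<bar> powr (- 1 / 2)"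
        by (intro mult_right_mono f_le_1) auto
      ultimately show ?thesis by (simp add: abs_mult)
    qed auto
    then show "AE p in lborel. norm (f p * \<bar>snd p\<bar> powr (- 1 / 2)) \<le>
        norm (indicator {-R..R} (fst p) * (indicator {-R..R} (snd p) * \<bar>snd p\<bar> powr (- 1 / 2)))"
      by simp
  qed measurable
qed

text \<open>For each e > 0 the integral of \<open>h e\<close> vanishes by the steady weak form. The
  limit of the integrals is taken under the majorant \<open>D\<close>, which does not depend on
  \<open>e\<close>, with pointwise convergence off the axis.\<close>

lemma weak_identity:
  assumes W: "W > 0"
    and sol: "solves_euler_vorticity \<theta>\<^sub>0 \<theta>"
    and \<theta>: "\<And>t x. t \<ge> 0 \<Longrightarrow> \<theta> t x = f (x - t *\<^sub>R (W, 0))"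
  shows "integrable lborel (\<lambda>p. f p * (u p \<bullet> (snd p, - fst p)) / (norm p)\<^sup>2)"
    and "(LINT p|lborel. f p * (u p \<bullet> (snd p, - fst p)) / (norm p)\<^sup>2) = W * axis_moment"
proof -
  define h where "h = (\<lambda>e p. f p * ((u p - (W, 0)) \<bullet> (angle1 e p, angle2 e p)))"
  \<comment> \<open>The coefficient of 1/|p| collects |u^1 - W| \<le> potential_bound + W from
    \<open>angle1\<close> and |u^2| \<le> potential_bound from the regular part of
    \<open>angle2\<close>; the second summand is the smeared jump.\<close>
  define D where "D = (\<lambda>p. (2 * potential_bound + W) * (\<bar>f p\<bar> / norm p)
    + 2 * snd_bound * (\<bar>f p\<bar> * \<bar>snd p\<bar> powr (- 1 / 2)))"
  have [measurable]: "h e \<in> borel_measurable borel" for e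
    unfolding h_def inner_prod_def by measurable
  have D: "integrable lborel D"
    unfolding D_def using integrable_f_div_norm[THEN integrable_abs] integrable_f_snd_powr[THEN integrable_abs]
    by (intro Bochner_Integration.integrable_add integrable_mult_right) (simp_all add: abs_mult)
  have h_le_D: "\<bar>h e p\<bar> \<le> D p" if e: "e > 0" and y: "snd p \<noteq> 0" for e p
  proof (cases "f p = 0")
    case False
    then have p: "p \<in> box_of R" by (rule f_supp)
    have u1: "\<bar>fst (u p)\<bar> \<le> potential_bound" and u2: "\<bar>snd (u p)\<bar> \<le> potential_bound"
      using norm_fst_le[of "fst (u p)" "snd (u p)"] norm_snd_le[of "snd (u p)" "fst (u p)"] norm_u_le[OF p]
      by auto
    have "\<bar>snd (u p) * angle2 e p\<bar> \<le> \<bar>snd (u p)\<bar> * (1 / norm p + 2 / \<bar>snd p\<bar>)"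
      unfolding abs_mult by (intro mult_left_mono abs_angle2_le e y) auto
    also have "\<dots> = \<bar>snd (u p)\<bar> * (1 / norm p) + \<bar>snd (u p)\<bar> * (2 / \<bar>snd p\<bar>)"
      by (simp add: algebra_simps)
    also have "\<dots> \<le> potential_bound * (1 / norm p) + snd_bound * sqrt \<bar>snd p\<bar> * (2 / \<bar>snd p\<bar>)"
      by (intro add_mono mult_right_mono u2 abs_snd_u_le p) auto
    also have "snd_bound * sqrt \<bar>snd p\<bar> * (2 / \<bar>snd p\<bar>) = snd_bound * (2 * \<bar>snd p\<bar> powr (- 1 / 2))"
    proof -
      have "sqrt \<bar>snd p\<bar> * (2 / \<bar>snd p\<bar>) = 2 * (\<bar>snd p\<bar> powr (1 / 2) * \<bar>snd p\<bar> powr (-1))"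
        using y by (simp add: powr_half_sqrt powr_minus_divide)
      also have "\<dots> = 2 * \<bar>snd p\<bar> powr (- 1 / 2)"
        unfolding powr_add[symmetric] by simp
      finally show ?thesis by (simp only: mult.assoc)
    qed
    finally have 2: "\<bar>snd (u p) * angle2 e p\<bar> \<le> potential_bound * (1 / norm p)
        + snd_bound * (2 * \<bar>snd p\<bar> powr (- 1 / 2))" .
    have "\<bar>(fst (u p) - W) * angle1 e p\<bar> \<le> (potential_bound + W) * (1 / norm p)"
      unfolding abs_mult by (intro mult_mono abs_angle1_le e y) (use u1 W in auto)
    with 2 have "\<bar>(u p - (W, 0)) \<bullet> (angle1 e p, angle2 e p)\<bar>
        \<le> (2 * potential_bound + W) * (1 / norm p) + 2 * snd_bound * \<bar>snd p\<bar> powr (- 1 / 2)"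
      by (simp add: inner_prod_def ring_distribs add_divide_distrib)
    then have "\<bar>f p\<bar> * \<bar>(u p - (W, 0)) \<bullet> (angle1 e p, angle2 e p)\<bar>
        \<le> \<bar>f p\<bar> * ((2 * potential_bound + W) * (1 / norm p) + 2 * snd_bound * \<bar>snd p\<bar> powr (- 1 / 2))"
      by (intro mult_left_mono) auto
    also have "\<dots> = D p" by (simp add: D_def algebra_simps)
    finally show ?thesis by (simp only: h_def abs_mult)
  qed (simp add: h_def D_def)
  have h_int: "integrable lborel (h e)" if e: "e > 0" for e
  proof (rule Bochner_Integration.integrable_bound[OF D])
    show "AE p in lborel. norm (h e p) \<le> norm (D p)"
      using AE_lborel_plane_coords
      by eventually_elim (use h_le_D[OF e] in \<open>auto intro: order_trans[OF _ abs_ge_self]\<close>)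
  qed measurable
  have h_0: "(LINT p|lborel. h e p) = 0" if e: "e > 0" for e
  proof -
    \<comment> \<open>The box of half-width \<open>R\<close> lies in the disc |p|^2 \<le> 2 R^2, so
      the cutoff equals 1 on the support of \<open>f\<close>.\<close>
    define M where "M = 2 * R\<^sup>2"
    obtain P1 P2 where der: "\<And>p. (angle e M has_derivative (\<lambda>h. fst h * P1 p + snd h * P2 p)) (at p)"
      and P: "\<And>p. fst p * fst p + snd p * snd p \<le> M \<Longrightarrow> P1 p = angle1 e p"
        "\<And>p. fst p * fst p + snd p * snd p \<le> M \<Longrightarrow> P2 p = angle2 e p"
      using has_derivative_angle[OF e] by blast
    have sq: "fst p * fst p + snd p * snd p \<le> M" if "f p \<noteq> 0" for p
    proof -
      have "\<bar>fst p\<bar> \<le> R" "\<bar>snd p\<bar> \<le> R" using f_supp[OF that] by (auto simp: mem_box_of)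
      then have "(fst p)\<^sup>2 \<le> R\<^sup>2" "(snd p)\<^sup>2 \<le> R\<^sup>2" by (auto simp: abs_le_square_iff[symmetric])
      then show ?thesis by (simp add: M_def power2_eq_square)
    qed
    have hP: "h e = (\<lambda>p. f p * ((u p - (W, 0)) \<bullet> (P1 p, P2 p)))"
    proof
      show "h e p = f p * ((u p - (W, 0)) \<bullet> (P1 p, P2 p))" for p
        using sq[of p] P[of p] by (cases "f p = 0") (auto simp: h_def)
    qed
    have "(LINT p|lborel. f p * ((u p - (W, 0)) \<bullet> (P1 p, P2 p))) = 0"
    proof (rule steady_weak_form[OF W sol \<theta> smooth_angle[OF e] der])
      show "p \<in> box_of (sqrt (M + 1))" if "angle e M p \<noteq> 0" for p
      proof -
        have "fst p * fst p + snd p * snd p < M + 1"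
          using that cutoff_eq_0[of M p] by (force simp: angle_def)
        then have "\<bar>fst p\<bar>\<^sup>2 \<le> M + 1" "\<bar>snd p\<bar>\<^sup>2 \<le> M + 1"
          using zero_le_square[of "fst p"] zero_le_square[of "snd p"]
          unfolding power2_abs power2_eq_square by linarith+
        then show ?thesis unfolding mem_box_of by (auto intro: real_le_rsqrt)
      qed
      show "integrable lborel (\<lambda>p. f p * angle e M p)"
      proof (rule Bochner_Integration.integrable_bound[OF integrable_mult_right[OF integrable_f, of 2]])
        have "continuous_on UNIV (angle e M)"
          using has_derivative_continuous[OF der] by (simp add: continuous_on_eq_continuous_at)
        then have "angle e M \<in> borel_measurable borel" by (rule borel_measurable_continuous_onI)
        then show "(\<lambda>p. f p * angle e M p) \<in> borel_measurable lborel" by measurable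
        have "\<bar>f p * angle e M p\<bar> \<le> \<bar>2 * f p\<bar>" for p
        proof (cases "f p = 0")
          case False
          have "\<bar>snd p * rinv e (snd p)\<bar>\<^sup>2 \<le> 1"
            using e rinv_powers(2)[OF e, of "snd p"] by (simp add: power_mult_distrib add_pos_nonneg)
          then have 1: "\<bar>snd p * rinv e (snd p)\<bar> \<le> 1" by (simp add: abs_square_le_1)
          have "\<bar>arctan (fst p * rinv e (snd p))\<bar> \<le> 2"
            using arctan_bounded[of "fst p * rinv e (snd p)"] pi_less_4 by auto
          then have "\<bar>arctan (fst p * rinv e (snd p))\<bar> * \<bar>snd p * rinv e (snd p)\<bar> \<le> 2 * 1"
            using 1 by (intro mult_mono) auto
          then have "\<bar>angle e M p\<bar> \<le> 2"
            using cutoff_eq_1[OF sq[OF False]] by (simp add: angle_def abs_mult)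
          then have "\<bar>f p\<bar> * \<bar>angle e M p\<bar> \<le> \<bar>f p\<bar> * 2" by (intro mult_left_mono) auto
          then show ?thesis by (simp add: abs_mult)
        qed auto
        then show "AE p in lborel. norm (f p * angle e M p) \<le> norm (2 * f p)" by simp
      qed
      show "integrable lborel (\<lambda>p. f p * ((u p - (W, 0)) \<bullet> (P1 p, P2 p)))"
        using h_int[OF e] by (simp add: hP)
    qed
    then show ?thesis by (simp add: hP)
  qed
  define h0 where "h0 = (\<lambda>p. f p * ((u p - (W, 0)) \<bullet> (snd p / (norm p)\<^sup>2, - fst p / (norm p)\<^sup>2)))"
  define e where "e = (\<lambda>n. inverse (real (Suc n)))"
  have e: "e n > 0" for n by (simp add: e_def)
  have e0: "e \<longlonglongrightarrow> 0" unfolding e_def by (rule LIMSEQ_inverse_real_of_nat)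
  have [measurable]: "h0 \<in> borel_measurable borel"
    unfolding h0_def inner_prod_def by measurable
  have lim: "AE p in lborel. (\<lambda>n. h (e n) p) \<longlonglongrightarrow> h0 p"
    using AE_lborel_plane_coords
  proof eventually_elim
    case (elim p)
    then have p: "snd p \<noteq> 0" by simp
    show ?case
      unfolding h_def h0_def by (intro tendsto_intros tendsto_angle1[OF p e0] tendsto_angle2[OF p e0])
  qed
  have bound: "AE p in lborel. norm (h (e n) p) \<le> D p" for n
    using AE_lborel_plane_coords by eventually_elim (use h_le_D[OF e] in auto)
  have h0_int: "integrable lborel h0"
    by (rule integrable_dominated_convergence[OF _ _ D lim bound]) measurable
  have "(\<lambda>n. LINT p|lborel. h (e n) p) \<longlonglongrightarrow> (LINT p|lborel. h0 p)"
    by (rule integral_dominated_convergence[OF _ _ D lim bound]) measurable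
  then have h0_0: "(LINT p|lborel. h0 p) = 0"
    by (simp add: h_0[OF e] LIMSEQ_const_iff)
  \<comment> \<open>Moving the frame velocity (W, 0) to the other side produces W times the density
    of B.\<close>
  have eq: "f p * (u p \<bullet> (snd p, - fst p)) / (norm p)\<^sup>2 = h0 p + W * (f p * snd p / (norm p)\<^sup>2)" for p
    by (simp add: h0_def inner_prod_def algebra_simps diff_divide_distrib)
  show "integrable lborel (\<lambda>p. f p * (u p \<bullet> (snd p, - fst p)) / (norm p)\<^sup>2)"
    unfolding eq by (intro Bochner_Integration.integrable_add integrable_mult_right h0_int integrable_f_coord)
  show "(LINT p|lborel. f p * (u p \<bullet> (snd p, - fst p)) / (norm p)\<^sup>2) = W * axis_moment"
    unfolding eq
    by (subst Bochner_Integration.integral_add)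
       (intro integrable_mult_right h0_int integrable_f_coord | simp only: h0_0 integral_mult_right_zero axis_moment_def add_0)+
qed

end

section \<open>Steiner symmetry\<close>

text \<open>The slice condition enters as \<open>steiner\<close>: each horizontal slice contains,
  with a point, every point of the same height no farther from the vertical axis.\<close>

locale steiner_vortex_pair =
  fixes \<Omega> :: "(real \<times> real) set" and R :: real
  assumes open_\<Omega>: "open \<Omega>"
    and nonempty: "\<Omega> \<noteq> {}"
    and upper: "x \<in> \<Omega> \<Longrightarrow> snd x > 0"
    and in_box: "x \<in> \<Omega> \<Longrightarrow> x \<in> box_of R"
    and steiner: "(a, b) \<in> \<Omega> \<Longrightarrow> \<bar>c\<bar> \<le> \<bar>a\<bar> \<Longrightarrow> (c, b) \<in> \<Omega>"
begin

definition f :: "real \<times> real \<Rightarrow> real" where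
  "f x = indicator \<Omega> x - indicator (reflect_set \<Omega>) x"

lemma \<Omega>_borel [measurable]: "\<Omega> \<in> sets borel"
  using open_\<Omega> by simp

lemma indicator_reflect: "indicator (reflect_set \<Omega>) y = (indicator \<Omega> (fst y, - snd y) :: real)"
  by (simp add: reflect_set_def indicator_def)

lemma f_eq: "f y = indicator \<Omega> y - indicator \<Omega> (fst y, - snd y)"
  by (simp add: f_def indicator_reflect)

sublocale odd_vorticity f R
proof
  show "f \<in> borel_measurable borel"
    unfolding f_eq by measurable
  show "\<bar>f x\<bar> \<le> 1" for x by (auto simp: f_eq indicator_def)
  show "f (a, - b) = - f (a, b)" for a b by (simp add: f_eq)
  show "x \<in> box_of R" if "f x \<noteq> 0" for x
  proof -
    have "x \<in> \<Omega> \<or> (fst x, - snd x) \<in> \<Omega>" using that by (auto simp: f_eq indicator_def)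
    then show ?thesis using in_box[of x] in_box[of "(fst x, - snd x)"] by (auto simp: mem_box_of)
  qed
qed

lemma f_upper: "snd y > 0 \<Longrightarrow> f y = indicator \<Omega> y"
  using upper[of "(fst y, - snd y)"] by (auto simp: f_eq indicator_def)

lemma f_even: "f (- a, b) = f (a, b)"
  using steiner[of a b "- a"] steiner[of "- a" b a] steiner[of a "- b" "- a"] steiner[of "- a" "- b" a]
  by (auto simp: f_eq indicator_def)

text \<open>Method of images: the vertical velocity at \<open>x\<close> induced by a unit vortex at
  \<open>y\<close> together with the opposite vortex at its mirror point. It folds the integral over
  the plane into one over \<Omega>.\<close>

definition image_kernel :: "real \<times> real \<Rightarrow> real \<times> real \<Rightarrow> real" where
  "image_kernel x y = snd (biot_savart (x - y)) - snd (biot_savart (x - (fst y, - snd y)))"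

lemma integrable_image_kernel: "integrable lborel (\<lambda>y. indicator \<Omega> y * image_kernel x y)"
  and snd_u_eq: "snd (u x) = (LINT y|lborel. indicator \<Omega> y * image_kernel x y)"
proof -
  define k where "k = (\<lambda>y. snd (biot_savart (x - y)))"
  have [measurable]: "k \<in> borel_measurable borel" unfolding k_def by measurable
  have i: "integrable lborel (\<lambda>y. f y * k y)" unfolding k_def by (rule integrable_snd_u)
  have 1: "integrable lborel (\<lambda>y. indicator \<Omega> y * k y)"
    using i by (rule Bochner_Integration.integrable_bound)
      (auto simp: f_upper upper indicator_def abs_mult)
  \<comment> \<open>Disjointness prevents cancellation in \<open>f\<close>, so each half is
    dominated by |f k| and may be integrated separately.\<close>
  have disj: "y \<notin> \<Omega> \<or> (fst y, - snd y) \<notin> \<Omega>" for y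
    using upper[of y] upper[of "(fst y, - snd y)"] by auto
  have 4: "integrable lborel (\<lambda>y. indicator \<Omega> (fst y, - snd y) * k y)"
    using i
  proof (rule Bochner_Integration.integrable_bound)
    have "\<bar>indicator \<Omega> (fst y, - snd y) * k y\<bar> \<le> \<bar>f y * k y\<bar>" for y
      using disj[of y] by (auto simp: f_eq indicator_def)
    then show "AE y in lborel. norm (indicator \<Omega> (fst y, - snd y) * k y) \<le> norm (f y * k y)"
      by simp
  qed measurable
  then have 2: "integrable lborel (\<lambda>y. indicator \<Omega> y * k (fst y, - snd y))"
    using integrable_plane_rigid[of "(1,-1)" "\<lambda>y. indicator \<Omega> (fst y, - snd y) * k y" "(0,0)"]
    by simp
  have 3: "(LINT y|lborel. indicator \<Omega> (fst y, - snd y) * k y)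
      = (LINT y|lborel. indicator \<Omega> y * k (fst y, - snd y))"
    using integral_reflect_snd[of "\<lambda>y. indicator \<Omega> (fst y, - snd y) * k y"] by simp
  have split: "indicator \<Omega> y * image_kernel x y = indicator \<Omega> y * k y - indicator \<Omega> y * k (fst y, - snd y)" for y
    by (simp add: image_kernel_def k_def algebra_simps)
  show "integrable lborel (\<lambda>y. indicator \<Omega> y * image_kernel x y)"
    unfolding split using 1 2 by simp
  have "snd (u x) = (LINT y|lborel. indicator \<Omega> y * k y - indicator \<Omega> (fst y, - snd y) * k y)"
    unfolding snd_u f_eq k_def by (simp add: algebra_simps)
  then show "snd (u x) = (LINT y|lborel. indicator \<Omega> y * image_kernel x y)"
    unfolding split using 1 2 3 4 by simp
qed

text \<open>The vortex and its image have the same positive horizontal offset from \<open>x\<close>,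
  but the image is farther away, so its opposite contribution is weaker.\<close>

lemma image_kernel_pos:
  assumes "fst y < fst x" "snd x > 0" "snd y > 0"
  shows "image_kernel x y > 0"
proof -
  obtain a p b q where xy: "x = (a, p)" "y = (b, q)" by (cases x; cases y)
  have "(a - b)\<^sup>2 > 0" using assms(1) by (simp add: xy)
  moreover have "(p - q)\<^sup>2 < (p + q)\<^sup>2"
    using assms(2,3) by (simp add: xy power2_eq_square algebra_simps)
  ultimately have "(a - b) / (2 * pi * ((a - b)\<^sup>2 + (p + q)\<^sup>2)) < (a - b) / (2 * pi * ((a - b)\<^sup>2 + (p - q)\<^sup>2))"
    using assms(1) by (intro divide_strict_left_mono mult_strict_left_mono mult_pos_pos)
      (auto simp: xy add_pos_nonneg)
  then show ?thesis by (simp add: image_kernel_def snd_biot_savart xy norm_Pair)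
qed

lemma image_kernel_reflect: "image_kernel x (2 * fst x - fst y, snd y) = - image_kernel x y"
proof -
  have "norm (x - (2 * fst x - fst y, snd y)) = norm (x - y)"
    "norm (x - (2 * fst x - fst y, - snd y)) = norm (x - (fst y, - snd y))"
    by (cases x; cases y; simp add: norm_Pair power2_eq_square algebra_simps)+
  then show ?thesis by (simp add: image_kernel_def snd_biot_savart diff_divide_distrib)
qed

text \<open>By oddness about the line \<open>y\<^sub>1 = x\<^sub>1\<close>, only the points of \<open>\<Omega>\<close> whose mirror image lies
  outside \<open>\<Omega>\<close> contribute, and Steiner symmetry puts these to the left of that line.\<close>

lemma snd_u_pos:
  assumes x: "fst x > 0" "snd x > 0"
  shows "snd (u x) > 0"
proof -
  define m where "m = (\<lambda>y::real\<times>real. (2 * fst x - fst y, snd y))"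
  have [measurable]: "m \<in> borel_measurable borel"
    unfolding m_def by (intro borel_measurable_continuous_onI continuous_intros)
  have Dm[measurable]: "image_kernel x \<in> borel_measurable borel"
    unfolding image_kernel_def[abs_def] by measurable
  \<comment> \<open>\<open>?g\<close> lives on the part of \<Omega> that is invariant under
    \<open>m\<close> and integrates to 0; \<open>?q\<close> is the rest.\<close>
  let ?g = "\<lambda>y. indicator \<Omega> (m y) * (indicator \<Omega> y * image_kernel x y)"
  let ?q = "\<lambda>y. (1 - indicator \<Omega> (m y)) * (indicator \<Omega> y * image_kernel x y)"
  have mm: "m (m y) = y" and Dm': "image_kernel x (m y) = - image_kernel x y" for y
    by (simp_all add: m_def image_kernel_reflect)
  have g: "integrable lborel ?g" and q: "integrable lborel ?q"
    by (rule Bochner_Integration.integrable_bound[OF integrable_image_kernel[of x]]; force simp: indicator_def)+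
  have "(LINT y|lborel. ?g (m y)) = (LINT y|lborel. ?g y)"
    using integral_plane_rigid[of "(-1,1)" ?g "(2 * fst x, 0)"] by (simp add: m_def)
  moreover have "?g (m y) = - ?g y" for y by (simp add: mm Dm')
  ultimately have g0: "(LINT y|lborel. ?g y) = 0" by simp
  have "snd (u x) = (LINT y|lborel. ?g y + ?q y)"
    unfolding snd_u_eq by (simp add: algebra_simps)
  also have "\<dots> = (LINT y|lborel. ?q y)"
    by (subst Bochner_Integration.integral_add[OF g q]) (simp only: g0 add_0)
  finally have eq: "snd (u x) = (LINT y|lborel. ?q y)" .
  have left: "fst y < fst x" if "y \<in> \<Omega>" "m y \<notin> \<Omega>" for y
  proof (rule ccontr)
    assume "\<not> ?thesis"
    then have "\<bar>2 * fst x - fst y\<bar> \<le> \<bar>fst y\<bar>" using x by auto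
    with that show False using steiner[of "fst y" "snd y"] by (simp add: m_def)
  qed
  define s where "s = Sup (fst ` \<Omega>)"
  have bdd: "bdd_above (fst ` \<Omega>)"
    by (rule bdd_aboveI[of _ R]) (use in_box in \<open>fastforce simp: mem_box_of\<close>)
  \<comment> \<open>Points left of 2 x_1 - s have their mirror image beyond the supremum s, hence
    outside \<Omega>. Such points exist because the slices are symmetric, so \<Omega> comes
    arbitrarily close to -s, and -s < 2 x_1 - s.\<close>
  define V where "V = \<Omega> \<inter> {y. fst y < 2 * fst x - s}"
  have "(LINT y|lborel. ?q y) > 0"
  proof (rule integral_pos_if_open[OF q])
    show "?q y \<ge> 0" for y
      using image_kernel_pos[OF left[of y] x(2)] upper[of y] by (auto simp: indicator_def intro: less_imp_le)
    show "open V"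
      unfolding V_def by (intro open_Int open_\<Omega> open_Collect_less continuous_intros)
    have "s - 2 * fst x < Sup (fst ` \<Omega>)" using x by (simp add: s_def)
    then obtain y where y: "y \<in> \<Omega>" "s - 2 * fst x < fst y"
      using less_cSup_iff[OF _ bdd] nonempty by auto
    then have "(- fst y, snd y) \<in> V"
      using steiner[of "fst y" "snd y" "- fst y"] by (auto simp: V_def)
    then show "V \<noteq> {}" by blast
    show "?q y > 0" if "y \<in> V" for y
    proof -
      have "m y \<notin> \<Omega>"
      proof
        assume "m y \<in> \<Omega>"
        then have "fst (m y) \<le> s" unfolding s_def by (intro cSup_upper bdd) auto
        then show False using that by (simp add: V_def m_def)
      qed
      then show ?thesis
        using that left[of y] upper[of y] image_kernel_pos[of y x] x by (auto simp: V_def)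
    qed
  qed
  then show ?thesis by (simp add: eq)
qed

lemma snd_u_reflect_fst: "snd (u (- a, b)) = - snd (u (a, b))"
proof -
  let ?k = "\<lambda>y. f y * snd (biot_savart ((- a, b) - y))"
  have "snd (u (- a, b)) = (LINT y|lborel. ?k (- fst y, snd y))"
    unfolding snd_u using integral_plane_rigid[of "(-1,1)" ?k "(0,0)"] by simp
  also have "\<dots> = (LINT y|lborel. - (f y * snd (biot_savart ((a, b) - y))))"
  proof (rule Bochner_Integration.integral_cong[OF refl])
    fix y :: "real \<times> real"
    have "norm ((- a, b) - (- fst y, snd y)) = norm ((a, b) - y)"
      by (cases y) (simp add: norm_Pair power2_eq_square algebra_simps)
    then show "?k (- fst y, snd y) = - (f y * snd (biot_savart ((a, b) - y)))"
      unfolding snd_biot_savart by (simp add: f_even minus_divide_left[symmetric] diff_divide_distrib algebra_simps)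
  qed
  also have "\<dots> = - snd (u (a, b))" by (simp add: snd_u)
  finally show ?thesis .
qed

text \<open>Reflection in either axis flips the sign of exactly two of the three factors, so the
  claim reduces to the closed first quadrant. On its boundary the product is 0.\<close>

lemma f_snd_u_fst_nonneg: "f x * snd (u x) * fst x \<ge> 0"
proof -
  let ?g = "\<lambda>a b. f (a, b) * snd (u (a, b)) * a"
  have g: "?g \<bar>a\<bar> \<bar>b\<bar> = ?g a b" for a b
    by (simp add: abs_if f_even f_odd snd_u_reflect snd_u_reflect_fst)
  have "?g a b \<ge> 0" if "a \<ge> 0" "b \<ge> 0" for a b
  proof (cases "a = 0 \<or> b = 0")
    case True
    then show ?thesis using f_odd[of a 0] by auto
  next
    case False
    then show ?thesis using that snd_u_pos[of "(a, b)"] by (simp add: f_upper)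
  qed
  from this[of "\<bar>fst x\<bar>" "\<bar>snd x\<bar>"] show ?thesis unfolding g by simp
qed

lemma f_snd_u_fst_pos:
  assumes "x \<in> \<Omega>" "fst x > 0"
  shows "f x * snd (u x) * fst x > 0"
  using assms upper[of x] snd_u_pos[of x] by (simp add: f_upper)

lemma axis_moment_pos: "axis_moment > 0"
  unfolding axis_moment_def
proof (rule integral_pos_if_open[OF integrable_f_coord(2) _ open_\<Omega> nonempty])
  show "f y * snd y / (norm y)\<^sup>2 \<ge> 0" for y
    using upper[of y] upper[of "(fst y, - snd y)"]
    by (auto simp: f_eq indicator_def divide_nonpos_nonneg)
  show "f y * snd y / (norm y)\<^sup>2 > 0" if "y \<in> \<Omega>" for y
  proof -
    have "y \<noteq> 0" using upper[OF that] by auto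
    then show ?thesis using upper[OF that] that by (simp add: f_upper)
  qed
qed

text \<open>Subtracting the weak identity from the symmetrized one leaves B (B/(4\<pi>) - W) equal
  to an integral with nonnegative integrand, strictly positive on the right half of
  \<Omega>.\<close>

lemma speed_bound:
  assumes "W > 0" "solves_euler_vorticity \<theta>\<^sub>0 \<theta>"
    and "\<And>t x. t \<ge> 0 \<Longrightarrow> \<theta> t x = f (x - t *\<^sub>R (W, 0))"
  shows "fst (u 0) > 2 * W"
proof -
  note weak = weak_identity[OF assms]
  have eq: "f p * (u p \<bullet> (snd p, fst p)) / (norm p)\<^sup>2 - f p * (u p \<bullet> (snd p, - fst p)) / (norm p)\<^sup>2
      = 2 * (f p * snd (u p) * fst p) / (norm p)\<^sup>2" for p
    by (simp add: inner_prod_def diff_divide_distrib[symmetric] algebra_simps)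
  have int: "integrable lborel (\<lambda>p. 2 * (f p * snd (u p) * fst p) / (norm p)\<^sup>2)"
    using Bochner_Integration.integrable_diff[OF symmetrized_identity(1) weak(1)] unfolding eq .
  have "0 < (LINT p|lborel. 2 * (f p * snd (u p) * fst p) / (norm p)\<^sup>2)"
  proof (rule integral_pos_if_open[OF int, where V = "\<Omega> \<inter> {p. fst p > 0}"])
    show "open (\<Omega> \<inter> {p. fst p > 0})"
      by (intro open_Int open_\<Omega> open_Collect_less continuous_intros)
    obtain p where "p \<in> \<Omega>" using nonempty by blast
    then obtain e where e: "e > 0" "ball p e \<subseteq> \<Omega>"
      using open_\<Omega> open_contains_ball by blast
    \<comment> \<open>The shift by half the radius covers a point \<open>p\<close> on the vertical
      axis. For a point on the left the shift goes outwards and \<open>steiner\<close> carries it to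
      the right.\<close>
    have "(\<bar>fst p\<bar> + e / 2, snd p) \<in> \<Omega>"
    proof (cases "fst p \<ge> 0")
      case True
      have "dist p (\<bar>fst p\<bar> + e / 2, snd p) < e"
        using True e(1) by (cases p) (simp add: dist_Pair_Pair dist_real_def)
      then show ?thesis using e(2) by (auto simp: mem_ball)
    next
      case False
      have "dist p (fst p - e / 2, snd p) < e"
        using e(1) by (cases p) (simp add: dist_Pair_Pair dist_real_def)
      then have "(fst p - e / 2, snd p) \<in> \<Omega>" using e(2) by (auto simp: mem_ball)
      then show ?thesis using False e(1) by (elim steiner) auto
    qed
    then show "\<Omega> \<inter> {p. fst p > 0} \<noteq> {}" using e(1) by force
    show "2 * (f p * snd (u p) * fst p) / (norm p)\<^sup>2 \<ge> 0" for p
      using f_snd_u_fst_nonneg[of p] by simp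
    show "2 * (f p * snd (u p) * fst p) / (norm p)\<^sup>2 > 0" if "p \<in> \<Omega> \<inter> {p. fst p > 0}" for p
      using that f_snd_u_fst_pos[of p] by (intro divide_pos_pos) auto
  qed
  also have "\<dots> = axis_moment\<^sup>2 / (4 * pi) - W * axis_moment"
    unfolding eq[symmetric] using symmetrized_identity weak by simp
  also have "\<dots> = axis_moment * (axis_moment / (4 * pi) - W)"
    by (simp add: power2_eq_square algebra_simps)
  \<comment> \<open>Cancelling B > 0 leaves B/(4\<pi>) > W, and u^1(0) = B/(2\<pi>) is twice the
    left-hand side.\<close>
  finally have "axis_moment / (4 * pi) - W > 0" using axis_moment_pos by (simp add: zero_less_mult_iff)
  then show ?thesis by (simp add: fst_u_0)
qed

end

theorem theorem1p4:
  fixes W :: real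
    and \<Omega> :: "(real \<times> real) set"
    and l :: "real \<Rightarrow> real"
    and \<theta> :: "real \<Rightarrow> real \<times> real \<Rightarrow> real"
  assumes "W > 0"
    and "\<Omega> \<subseteq> upper_half_plane" and "open \<Omega>" and "bounded \<Omega>"
    and "(LINT x:\<Omega>|lborel. snd x) > 0"
    and "\<And>s. s > 0 \<Longrightarrow> l s \<ge> 0"
    and "\<And>s. s > 0 \<Longrightarrow>
           {x \<in> \<Omega>. snd x = s} = {(x1, s) | x1. (x1, s) \<in> upper_half_plane \<and> \<bar>x1\<bar> < l s}"
    and "\<And>t x. t \<ge> 0 \<Longrightarrow>
           \<theta> t x = indicator \<Omega> (x - t *\<^sub>R (W, 0)) - indicator (reflect_set \<Omega>) (x - t *\<^sub>R (W, 0))"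
    and "solves_euler_vorticity (\<lambda>x. indicator \<Omega> x - indicator (reflect_set \<Omega>) x) \<theta>"
  shows "\<forall>t>0.
           fst (velocity \<theta> t (W * t, 0)) = fst (velocity \<theta> 0 (0, 0)) \<and>
           fst (velocity \<theta> 0 (0, 0)) > 2 * W \<and>
           snd (velocity \<theta> t (W * t, 0)) = snd (velocity \<theta> 0 (0, 0)) \<and>
           snd (velocity \<theta> 0 (0, 0)) = 0"
proof -
  obtain R where R: "\<And>x. x \<in> \<Omega> \<Longrightarrow> norm x \<le> R"
    using \<open>bounded \<Omega>\<close> by (auto simp: bounded_iff)
  interpret steiner_vortex_pair \<Omega> R
  proof
    \<comment> \<open>An empty \<Omega> would have vertical moment 0.\<close>
    show "\<Omega> \<noteq> {}" using assms(5) by (auto simp: set_lebesgue_integral_def)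
    show "snd x > 0" if "x \<in> \<Omega>" for x using that assms(2) by (auto simp: upper_half_plane_def)
    show "x \<in> box_of R" if "x \<in> \<Omega>" for x
      using R[OF that] norm_fst_le[of "fst x" "snd x"] norm_snd_le[of "snd x" "fst x"]
      by (simp add: mem_box_of)
    show "(c, b) \<in> \<Omega>" if ab: "(a, b) \<in> \<Omega>" and c: "\<bar>c\<bar> \<le> \<bar>a\<bar>" for a b c
    proof -
      have b: "b > 0" using ab assms(2) by (auto simp: upper_half_plane_def)
      have "(a, b) \<in> {x \<in> \<Omega>. snd x = b}" using ab by simp
      then have "\<bar>a\<bar> < l b" unfolding assms(7)[OF b] by simp
      then have "(c, b) \<in> {(x1, b) | x1. (x1, b) \<in> upper_half_plane \<and> \<bar>x1\<bar> < l b}"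
        using b c by (simp add: upper_half_plane_def)
      then show ?thesis unfolding assms(7)[OF b, symmetric] by simp
    qed
  qed (rule \<open>open \<Omega>\<close>)
  have \<theta>: "\<theta> t x = f (x - t *\<^sub>R (W, 0))" if "t \<ge> 0" for t x
    using assms(8)[OF that] by (simp add: f_def)
  \<comment> \<open>The point (W t, 0) is the origin carried along by the translation; t = 0 is
    included to cover the initial velocity.\<close>
  have v: "velocity \<theta> t (W * t, 0) = u 0" if "t \<ge> 0" for t
    using velocity_translate[of \<theta> t "t *\<^sub>R (W, 0)" "(W * t, 0)"] \<theta>[OF that]
    by (simp add: zero_prod_def mult.commute)
  have "velocity \<theta> 0 (0, 0) = u 0" using v[of 0] by simp
  then show ?thesis
    using v speed_bound[OF \<open>W > 0\<close> assms(9) \<theta>] snd_u_0 by simp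
qed

end
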